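(* Let $\Delta$ be a simplicial tree with the intersection property. Then $I(\Delta)$ and $I(\Delta)^{[2]}$ have linear quotients.
   Context: A simplicial complex $\Delta$ on a finite vertex set is a non-empty collection of subsets (faces) closed under taking subsets; its facets are the inclusion-maximal faces, and $\mathcal F(\Delta)$ is the set of facets. The dimension of a face $F$ is $|F|-1$ (so $\dim\emptyset=-1$), and $\Delta$ is pure if all facets have the same dimension. A subcollection of $\Delta$ is a simplicial complex $\Delta'$ with $\mathcal F(\Delta')\subseteq\mathcal F(\Delta)$. A facet $F$ of $\Delta$ is a leaf if either $F$ is the only facet of $\Delta$ or there is a facet $G\neq F$ of $\Delta$ with $H\cap F\subseteq G\cap F$ for all facets $H\ne F$ of $\Delta$. A connected simplicial complex is a simplicial tree if every nonempty subcollection of it has a leaf. $\Delta$ is connected in codimension 1 if for any two facets $F,G$ with $\dim F\ge\dim G$ there is a chain of facets $F=F_0,\ldots,F_n=G$ with $\dim(F_i\cap F_{i+1})=\dim(F_{i+1})-1$ for all $i=0,\dots,n-1$; such a chain is called a proper chain between $F$ and $G$ (of length $n$). A proper chain is irredundant if no subsequence of it other than itself is a proper chain between $F$ and $G$. In a pure $d$-dimensional simplicial tree connected in codimension 1, there is a unique irredundant proper chain between any two facets $F,G$ (a known result); its length is denoted $\mathrm{dist}(F,G)$. Such a $\Delta$ (pure $d$-dimensional simplicial tree connected in codimension 1) has the intersection property if for any two facets $F,G$ with $\dim(F\cap G)=d-k$ for some $k\in\{1,\ldots,d+1\}$ one has $\mathrm{dist}(F,G)=k$. Let $S$ be the polynomial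 ring over a field $K$ with variables $x_v$ indexed by the vertices of $\Delta$. The facet ideal $I(\Delta)\subseteq S$ is generated by the monomials $\prod_{v\in F}x_v$, $F\in\mathcal F(\Delta)$. For a squarefree monomial ideal $I$, $I^{[k]}$ is the ideal generated by the squarefree monomials among the minimal monomial generators of $I^k$. A homogeneous ideal $I$ has linear quotients if there is a system of homogeneous generators $f_1,\dots,f_m$ of $I$ such that $(f_1,\dots,f_{i-1}):f_i$ is generated by linear forms for all $i=1,\dots,m$ (the zero ideal satisfies this vacuously). *)

theory Defs
  imports
    "HOL-Algebra.Ideal_Product"
    "HOL-Library.Poly_Mapping"
    "HOL-Library.Sublist"
begin

section \<open>Simplicial complexes\<close>

definition simplicial_complex :: "'v set \<Rightarrow> 'v set set \<Rightarrow> bool" where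
  "simplicial_complex V \<Delta> \<longleftrightarrow>
     finite V \<and> \<Delta> \<subseteq> Pow V \<and> \<Delta> \<noteq> {} \<and> (\<forall>F\<in>\<Delta>. \<forall>G. G \<subseteq> F \<longrightarrow> G \<in> \<Delta>)"

definition facets :: "'v set set \<Rightarrow> 'v set set" where
  "facets \<Delta> = {F \<in> \<Delta>. \<forall>G\<in>\<Delta>. F \<subseteq> G \<longrightarrow> F = G}"

text \<open>The dimension is an integer, so that the empty face has dimension \<open>-1\<close>.\<close>

definition face_dim :: "'v set \<Rightarrow> int" where
  "face_dim F = int (card F) - 1"

definition pure_of_dim :: "'v set set \<Rightarrow> int \<Rightarrow> bool" where
  "pure_of_dim \<Delta> d \<longleftrightarrow> (\<forall>F\<in>facets \<Delta>. face_dim F = d)"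

definition subcollection :: "'v set \<Rightarrow> 'v set set \<Rightarrow> 'v set set \<Rightarrow> bool" where
  "subcollection V \<Delta>' \<Delta> \<longleftrightarrow> simplicial_complex V \<Delta>' \<and> facets \<Delta>' \<subseteq> facets \<Delta>"

definition leaf :: "'v set set \<Rightarrow> 'v set \<Rightarrow> bool" where
  "leaf \<Delta> F \<longleftrightarrow> F \<in> facets \<Delta> \<and>
     (facets \<Delta> = {F} \<or>
      (\<exists>G\<in>facets \<Delta>. G \<noteq> F \<and> (\<forall>H\<in>facets \<Delta>. H \<noteq> F \<longrightarrow> H \<inter> F \<subseteq> G \<inter> F)))"

text \<open>Connectedness: any two facets are joined by a sequence of facets in which consecutive
  members meet. The complex \<open>{{}}\<close> is connected.\<close>

definition connected_complex :: "'v set set \<Rightarrow> bool" where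
  "connected_complex \<Delta> \<longleftrightarrow>
     (\<forall>F\<in>facets \<Delta>. \<forall>G\<in>facets \<Delta>.
        (F, G) \<in> {(A, B). A \<in> facets \<Delta> \<and> B \<in> facets \<Delta> \<and> A \<inter> B \<noteq> {}}\<^sup>*)"

text \<open>A complex is by definition nonempty, so every subcollection is a nonempty one.\<close>

definition simplicial_tree :: "'v set \<Rightarrow> 'v set set \<Rightarrow> bool" where
  "simplicial_tree V \<Delta> \<longleftrightarrow>
     simplicial_complex V \<Delta> \<and> connected_complex \<Delta> \<and>
     (\<forall>\<Delta>'. subcollection V \<Delta>' \<Delta> \<longrightarrow> (\<exists>F. leaf \<Delta>' F))"

text \<open>The list \<open>[F\<^sub>0, \<dots>, F\<^sub>n]\<close> is a chain of length \<open>n\<close>, which is one less than its length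
  as a list.\<close>

definition proper_chain :: "'v set set \<Rightarrow> 'v set \<Rightarrow> 'v set \<Rightarrow> 'v set list \<Rightarrow> bool" where
  "proper_chain \<Delta> F G c \<longleftrightarrow>
     c \<noteq> [] \<and> set c \<subseteq> facets \<Delta> \<and> hd c = F \<and> last c = G \<and>
     (\<forall>i. Suc i < length c \<longrightarrow>
        face_dim (c ! i \<inter> c ! Suc i) = face_dim (c ! Suc i) - 1)"

definition connected_codim1 :: "'v set set \<Rightarrow> bool" where
  "connected_codim1 \<Delta> \<longleftrightarrow>
     (\<forall>F\<in>facets \<Delta>. \<forall>G\<in>facets \<Delta>. face_dim F \<ge> face_dim G \<longrightarrow> (\<exists>c. proper_chain \<Delta> F G c))"

definition irredundant_proper_chain :: "'v set set \<Rightarrow> 'v set \<Rightarrow> 'v set \<Rightarrow> 'v set list \<Rightarrow> bool" where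
  "irredundant_proper_chain \<Delta> F G c \<longleftrightarrow>
     proper_chain \<Delta> F G c \<and> (\<forall>c'. subseq c' c \<and> proper_chain \<Delta> F G c' \<longrightarrow> c' = c)"

text \<open>Meaningful in pure simplicial trees connected in codimension 1, where the irredundant
  proper chain between two facets is unique.\<close>

definition facet_dist :: "'v set set \<Rightarrow> 'v set \<Rightarrow> 'v set \<Rightarrow> nat" where
  "facet_dist \<Delta> F G = length (THE c. irredundant_proper_chain \<Delta> F G c) - 1"

definition intersection_property :: "'v set \<Rightarrow> 'v set set \<Rightarrow> bool" where
  "intersection_property V \<Delta> \<longleftrightarrow>
     (\<exists>d. pure_of_dim \<Delta> d \<and> simplicial_tree V \<Delta> \<and> connected_codim1 \<Delta> \<and>
        (\<forall>F\<in>facets \<Delta>. \<forall>G\<in>facets \<Delta>. \<forall>k\<in>{1..d + 1}.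
           face_dim (F \<inter> G) = d - k \<longrightarrow> int (facet_dist \<Delta> F G) = k))"

section \<open>Polynomial rings and monomial ideals\<close>

text \<open>An exponent vector is a finitely supported function \<open>m :: 'v \<Rightarrow>\<^sub>0 nat\<close>; the corresponding
  monomial is \<open>Poly_Mapping.single m 1\<close>. The ring \<open>poly_ring V\<close> consists of the polynomials
  involving only the variables indexed by \<open>V\<close>.\<close>

type_synonym ('v, 'k) mpoly = "('v \<Rightarrow>\<^sub>0 nat) \<Rightarrow>\<^sub>0 'k"

definition poly_ring :: "'v set \<Rightarrow> ('v, 'k::field) mpoly ring" where
  "poly_ring V =
     \<lparr> carrier = {p. \<forall>m\<in>Poly_Mapping.keys p. Poly_Mapping.keys m \<subseteq> V},
       mult = (*), one = 1, zero = 0, add = (+) \<rparr>"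

lemma cring_poly_ring: "cring (poly_ring V :: ('v, 'k::field) mpoly ring)"
proof -
  let ?S = "poly_ring V :: ('v, 'k) mpoly ring"
  have add: "p + q \<in> carrier ?S" if "p \<in> carrier ?S" "q \<in> carrier ?S" for p q
    using that Poly_Mapping.keys_add[of p q] by (fastforce simp: poly_ring_def)
  have neg: "- p \<in> carrier ?S" if "p \<in> carrier ?S" for p
    using that by (simp add: poly_ring_def)
  have mult: "p * q \<in> carrier ?S" if p: "p \<in> carrier ?S" and q: "q \<in> carrier ?S" for p q
  proof -
    have "Poly_Mapping.keys m \<subseteq> V" if m: "m \<in> Poly_Mapping.keys (p * q)" for m
    proof -
      obtain a b where ab: "a \<in> Poly_Mapping.keys p" "b \<in> Poly_Mapping.keys q" "m = a + b"
        using m Poly_Mapping.keys_mult[of p q] by blast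
      then show ?thesis
        using p q Poly_Mapping.keys_add[of a b] by (fastforce simp: poly_ring_def)
    qed
    then show ?thesis by (simp add: poly_ring_def)
  qed
  have one: "1 \<in> carrier ?S" and zero: "0 \<in> carrier ?S"
    by (simp_all add: poly_ring_def)
  have ops: "p \<oplus>\<^bsub>?S\<^esub> q = p + q" "p \<otimes>\<^bsub>?S\<^esub> q = p * q" "\<one>\<^bsub>?S\<^esub> = 1" "\<zero>\<^bsub>?S\<^esub> = 0" for p q
    by (simp_all add: poly_ring_def)
  show ?thesis
  proof (rule cringI)
    show "abelian_group ?S"
      by (rule abelian_groupI)
        (auto simp: ops add zero add.assoc add.commute intro: neg intro!: bexI[of _ "- _"])
    show "Group.comm_monoid ?S"
      by (rule Group.comm_monoidI) (auto simp: ops mult one mult.assoc mult.commute)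
  qed (simp add: ops distrib_right)
qed

definition var :: "'v \<Rightarrow> ('v, 'k::field) mpoly" where
  "var v = Poly_Mapping.single (Poly_Mapping.single v 1) 1"

definition monomials :: "'v set \<Rightarrow> ('v, 'k::field) mpoly set" where
  "monomials V = {Poly_Mapping.single m 1 | m. Poly_Mapping.keys m \<subseteq> V}"

definition squarefree_monomials :: "'v set \<Rightarrow> ('v, 'k::field) mpoly set" where
  "squarefree_monomials V =
     {Poly_Mapping.single m 1 | m.
        Poly_Mapping.keys m \<subseteq> V \<and> (\<forall>v. Poly_Mapping.lookup m v \<le> 1)}"

definition monomial_degree :: "('v \<Rightarrow>\<^sub>0 nat) \<Rightarrow> nat" where
  "monomial_degree m = (\<Sum>v\<in>Poly_Mapping.keys m. Poly_Mapping.lookup m v)"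

text \<open>The homogeneous polynomials of degree \<open>n\<close>, including \<open>0\<close>.\<close>

definition forms :: "'v set \<Rightarrow> nat \<Rightarrow> ('v, 'k::field) mpoly set" where
  "forms V n =
     {p \<in> carrier (poly_ring V). \<forall>m\<in>Poly_Mapping.keys p. monomial_degree m = n}"

definition facet_ideal :: "'v set \<Rightarrow> 'v set set \<Rightarrow> ('v, 'k::field) mpoly set" where
  "facet_ideal V \<Delta> = Idl\<^bsub>poly_ring V\<^esub> ((\<lambda>F. \<Prod>v\<in>F. var v) ` facets \<Delta>)"

text \<open>The members of the (unique) minimal set of monomials generating a monomial ideal \<open>J\<close>.\<close>

definition minimal_monomial_generators ::
    "'v set \<Rightarrow> ('v, 'k::field) mpoly set \<Rightarrow> ('v, 'k) mpoly set" where
  "minimal_monomial_generators V J =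
     {u. \<exists>M. M \<subseteq> monomials V \<and> Idl\<^bsub>poly_ring V\<^esub> M = J \<and>
             (\<forall>M'. M' \<subset> M \<longrightarrow> Idl\<^bsub>poly_ring V\<^esub> M' \<noteq> J) \<and> u \<in> M}"

definition squarefree_power ::
    "'v set \<Rightarrow> ('v, 'k::field) mpoly set \<Rightarrow> nat \<Rightarrow> ('v, 'k) mpoly set" where
  "squarefree_power V I k =
     Idl\<^bsub>poly_ring V\<^esub> (squarefree_monomials V \<inter>
       minimal_monomial_generators V (I [^]\<^bsub>ideals_set (poly_ring V)\<^esub> k))"

definition colon_ideal ::
    "'v set \<Rightarrow> ('v, 'k::field) mpoly set \<Rightarrow> ('v, 'k) mpoly \<Rightarrow> ('v, 'k) mpoly set" where
  "colon_ideal V I f = {g \<in> carrier (poly_ring V). g \<otimes>\<^bsub>poly_ring V\<^esub> f \<in> I}"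

text \<open>The zero ideal has linear quotients by way of the empty list of generators. An ideal
  generated by linear forms may be generated by the empty set, as is the first colon ideal
  \<open>(0) : f\<^sub>1\<close> when \<open>f\<^sub>1 \<noteq> 0\<close>.\<close>

definition has_linear_quotients :: "'v set \<Rightarrow> ('v, 'k::field) mpoly set \<Rightarrow> bool" where
  "has_linear_quotients V I \<longleftrightarrow>
     (\<exists>fs. (\<forall>f\<in>set fs. \<exists>n. f \<in> forms V n) \<and>
           Idl\<^bsub>poly_ring V\<^esub> (set fs) = I \<and>
           (\<forall>i<length fs. \<exists>L\<subseteq>forms V 1.
              colon_ideal V (Idl\<^bsub>poly_ring V\<^esub> (set (take i fs))) (fs ! i) =
              Idl\<^bsub>poly_ring V\<^esub> L))"

end

theory Submission
  imports Defs
begin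

text \<open>
  Every facet has \<open>n = d + 1\<close> vertices. Two facets are adjacent if they share \<open>n - 1\<close> of them.

  The intersection property says that \<open>dist(F, G) = |F - G|\<close> for distinct facets. A single step
  of a proper chain removes at most one element of \<open>F - G\<close>, so a chain of this length makes no
  wasted step: already its first step trades an element of \<open>F - G\<close> for one of \<open>G - F\<close>. Hence the
  facets satisfy an exchange property (\<open>exchange_facets\<close>). To read it off from the definition of the
  distance, which picks the irredundant proper chain, one needs that this chain is unique (\<open>induced_path_unique\<close>): irredundant
  chains are induced paths of the adjacency graph, and a leaf of the tree is a vertex of that graph whose
  neighbours form a clique.

  Order the facets so that each one is a leaf among those up to it. Removing a leaf preserves the
  exchange property (\<open>exchange_remove_leaf\<close>). So if \<open>G\<close> precedes \<open>L\<close>, then some \<open>L - x + y\<close> with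
  \<open>y \<in> G - L\<close> precedes \<open>L\<close> as well; its monomial contributes the variable of \<open>y\<close> to the
  colon ideal, and this variable divides what the monomial of \<open>G\<close> contributes. This settles the facet ideal.

  All products of two facet monomials have the same degree, so the squarefree square is
  generated by the monomials of \<open>F \<union> G\<close> for disjoint facets \<open>F\<close> and \<open>G\<close>. Remove a leaf \<open>L\<close>,
  list the unions of two other facets by induction, and append the unions \<open>L \<union> G\<close> in a linear quotient order of
  the facets \<open>G\<close> disjoint from \<open>L\<close>, which again have the exchange property. Only the comparison of
  \<open>L \<union> G\<close> with an earlier \<open>H\<^sub>1 \<union> H\<^sub>2\<close> is new. Stepping from \<open>L\<close> towards
  \<open>H\<^sub>1\<close> and towards \<open>H\<^sub>2\<close> gives facets \<open>A + y\<^sub>1\<close> and \<open>A + y\<^sub>2\<close>, where \<open>A\<close> is the set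
  of the non-free vertices of the leaf. If \<open>y\<^sub>i\<close> is not in \<open>G\<close>, then \<open>(A + y\<^sub>i) \<union> G\<close>
  is an earlier union that adds the single vertex \<open>y\<^sub>i\<close>. If both lie in \<open>G\<close>, then \<open>A + y\<^sub>1\<close>,
  \<open>A + y\<^sub>2\<close> and \<open>G\<close> form a triple without a leaf (\<open>no_special_triangle\<close>), which a
  tree does not contain.
\<close>

section \<open>Uniform families of sets in which every subfamily has a leaf\<close>

definition adjacent :: "'v set \<Rightarrow> 'v set \<Rightarrow> bool" where
  "adjacent F G \<longleftrightarrow> Suc (card (F \<inter> G)) = card F \<and> card F = card G"

lemma adjacent_commute: "adjacent F G \<longleftrightarrow> adjacent G F"
  by (auto simp: adjacent_def Int_commute)

lemma not_adjacent_refl [simp]: "\<not> adjacent F F"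
  by (simp add: adjacent_def)

text \<open>Families of facets replace complexes here because the proofs remove single facets and pass to
  arbitrary subfamilies; \<open>leaf_of\<close> is the notion of a leaf read off from the set of facets.\<close>

definition leaf_of :: "'v set set \<Rightarrow> 'v set \<Rightarrow> bool" where
  "leaf_of \<F> L \<longleftrightarrow>
     L \<in> \<F> \<and> (\<F> = {L} \<or> (\<exists>J\<in>\<F>. J \<noteq> L \<and> (\<forall>H\<in>\<F>. H \<noteq> L \<longrightarrow> H \<inter> L \<subseteq> J \<inter> L)))"

locale uniform_forest =
  fixes \<F> :: "'v set set" and n :: nat
  assumes finite_family: "finite \<F>"
    and finite_member: "F \<in> \<F> \<Longrightarrow> finite F"
    and card_member: "F \<in> \<F> \<Longrightarrow> card F = n"
    and ex_leaf: "\<G> \<subseteq> \<F> \<Longrightarrow> \<G> \<noteq> {} \<Longrightarrow> \<exists>L. leaf_of \<G> L"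
begin

lemma subfamily: "\<G> \<subseteq> \<F> \<Longrightarrow> uniform_forest \<G> n"
  using finite_family finite_member card_member ex_leaf
  by unfold_locales (blast intro: finite_subset)+

lemma member_eqI: "F \<in> \<F> \<Longrightarrow> G \<in> \<F> \<Longrightarrow> F \<subseteq> G \<Longrightarrow> F = G"
  using card_subset_eq finite_member card_member by metis

lemma card_Int_less: "F \<in> \<F> \<Longrightarrow> G \<in> \<F> \<Longrightarrow> F \<noteq> G \<Longrightarrow> card (F \<inter> G) < n"
  by (metis Int_lower1 card_member finite_member inf.absorb_iff1 member_eqI psubsetI psubset_card_mono)

lemma adjacentI:
  assumes "F \<in> \<F>" "G \<in> \<F>" "F \<noteq> G" "C \<subseteq> F" "C \<subseteq> G" "Suc (card C) = n"
  shows "adjacent F G"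
proof -
  have "card C \<le> card (F \<inter> G)"
    using assms finite_member by (intro card_mono) auto
  then show ?thesis
    using card_Int_less[OF assms(1-3)] assms card_member by (simp add: adjacent_def)
qed

text \<open>Every neighbour of a leaf meets it in an \<open>(n - 1)\<close>-set, which must fill the intersection of the
  leaf with its joint. Consequently the neighbours share this set and form a clique.\<close>

lemma leaf_neighbours:
  assumes "leaf_of \<F> L" "G \<in> \<F>" "H \<in> \<F>" "adjacent G L" "adjacent H L"
  shows "G \<inter> L = H \<inter> L"
proof -
  have L: "L \<in> \<F>" and "G \<noteq> L" "H \<noteq> L"
    using assms by (auto simp: leaf_of_def)
  then obtain J where J: "J \<in> \<F>" "J \<noteq> L" "\<And>K. K \<in> \<F> \<Longrightarrow> K \<noteq> L \<Longrightarrow> K \<inter> L \<subseteq> J"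
    using assms by (auto simp: leaf_of_def)
  have "K \<inter> L = J \<inter> L" if "K \<in> \<F>" "adjacent K L" for K
  proof (rule card_seteq)
    show "finite (J \<inter> L)" using J finite_member by blast
    show "K \<inter> L \<subseteq> J \<inter> L" using J(3)[of K] that by (cases "K = L") auto
    show "card (J \<inter> L) \<le> card (K \<inter> L)"
      using card_Int_less[OF J(1) L J(2)] that card_member by (auto simp: adjacent_def)
  qed
  then show ?thesis using assms by blast
qed

lemma leaf_neighbours_adjacent:
  assumes "leaf_of \<F> L" "G \<in> \<F>" "H \<in> \<F>" "adjacent G L" "adjacent H L" "G \<noteq> H"
  shows "adjacent G H"
  using assms leaf_neighbours[OF assms(1-5)] card_member
  by (intro adjacentI[where C = "G \<inter> L"]) (auto simp: adjacent_def)

text \<open>Three sets of size \<open>n\<close> can be pairwise adjacent in two ways: they share an \<open>(n - 1)\<close>-set, or they lie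
  in an \<open>(n + 1)\<close>-set. In the second case the three are a family without a leaf.\<close>

lemma triangle_inter_subset:
  assumes PQR: "P \<in> \<F>" "Q \<in> \<F>" "R \<in> \<F>"
    and adj: "adjacent P Q" "adjacent P R" "adjacent Q R"
  shows "P \<inter> Q \<subseteq> R"
proof -
  interpret T: uniform_forest "{P, Q, R}" n
    using PQR by (intro subfamily) auto
  obtain L where L: "leaf_of {P, Q, R} L"
    using T.ex_leaf by blast
  then consider "L = P" | "L = Q" | "L = R" by (auto simp: leaf_of_def)
  then show ?thesis
  proof cases
    case 1
    then show ?thesis using T.leaf_neighbours[OF L, of Q R] adj adjacent_commute by auto
  next
    case 2
    then show ?thesis using T.leaf_neighbours[OF L, of P R] adj adjacent_commute by auto
  next
    case 3
    then have "P \<inter> R = Q \<inter> R" using T.leaf_neighbours[OF L, of P Q] adj by auto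
    then have "P \<inter> R = P \<inter> Q"
      using adj PQR finite_member by (intro card_subset_eq) (auto simp: adjacent_def)
    then show ?thesis by blast
  qed
qed

end

section \<open>Uniqueness of induced paths\<close>

fun induced_path :: "'v set list \<Rightarrow> bool" where
  "induced_path [] \<longleftrightarrow> False"
| "induced_path [F] \<longleftrightarrow> True"
| "induced_path (F # G # c) \<longleftrightarrow>
     adjacent F G \<and> (\<forall>H\<in>set c. H \<noteq> F \<and> \<not> adjacent F H) \<and> induced_path (G # c)"

lemma induced_path_appendD: "induced_path (b @ c) \<Longrightarrow> c \<noteq> [] \<Longrightarrow> induced_path c"
proof (induction b)
  case (Cons F b)
  then show ?case by (cases "b @ c") auto
qed simp

lemma induced_path_snoc:
  "c \<noteq> [] \<Longrightarrow> induced_path (c @ [H]) \<longleftrightarrow>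
     induced_path c \<and> adjacent (last c) H \<and> (\<forall>F\<in>set (butlast c). F \<noteq> H \<and> \<not> adjacent F H)"
  by (induction c rule: induced_path.induct) auto

lemma induced_path_appendD1: "induced_path (b @ c) \<Longrightarrow> b \<noteq> [] \<Longrightarrow> induced_path b"
proof (induction c rule: rev_induct)
  case (snoc H c)
  then show ?case using induced_path_snoc[of "b @ c" H] by auto
qed simp

lemma induced_path_rev: "induced_path (rev c) = induced_path c"
proof (induction c rule: induced_path.induct)
  case (3 F G c)
  then show ?case
    using induced_path_snoc[of "rev (G # c)" F] adjacent_commute by (auto simp: butlast_append)
qed auto

lemma induced_path_notin: "induced_path (F # c) \<Longrightarrow> F \<notin> set c"
proof (cases c)
  case (Cons G d)
  assume "induced_path (F # c)"
  then have "adjacent F G" "\<forall>H\<in>set d. H \<noteq> F" using Cons by simp_all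
  then have "F \<noteq> G" "F \<notin> set d" by (metis not_adjacent_refl)+
  then show ?thesis using Cons by simp
qed simp

text \<open>The second vertices \<open>a\<close> and \<open>b\<close> of the two paths are neighbours of the leaf. If they differ, then they
  are adjacent, and prepending \<open>b\<close> to the path through \<open>a\<close> yields a second path from \<open>b\<close> that avoids the
  leaf. It differs from the given one, so it is not induced, and \<open>b\<close> is adjacent
  to a vertex \<open>z\<close> after \<open>a\<close>. If \<open>z\<close> follows \<open>a\<close> immediately, there is a triangle; if not, then
  \<open>a\<close>, \<open>b\<close>, \<open>z\<close> is a second induced path from \<open>a\<close> to \<open>z\<close>.\<close>

lemma (in uniform_forest) induced_paths_from_leaf_eq:
  assumes L: "leaf_of \<F> L"
    and paths: "induced_path (L # p)" "induced_path (L # q)" "set p \<subseteq> \<F>" "set q \<subseteq> \<F>"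
    and last: "last (L # p) = last (L # q)"
    and unique: "\<And>p q. induced_path p \<Longrightarrow> induced_path q \<Longrightarrow> set p \<subseteq> \<F> - {L} \<Longrightarrow> set q \<subseteq> \<F> - {L} \<Longrightarrow>
      hd p = hd q \<Longrightarrow> last p = last q \<Longrightarrow> p = q"
  shows "p = q"
proof -
  have notin: "L \<notin> set p" "L \<notin> set q" using paths induced_path_notin by blast+
  show ?thesis
  proof (cases "p = [] \<or> q = []")
    case True
    then show ?thesis using last notin last_in_set by (metis last.simps)
  next
    case False
    then obtain a p' b q' where p: "p = a # p'" and q: "q = b # q'"
      by (meson list.exhaust)
    have adj: "adjacent L a" "adjacent L b" using paths p q by auto
    have "a = b"
    proof (rule ccontr)
      assume "a \<noteq> b"
      have ab: "a \<in> \<F>" "b \<in> \<F>" using paths p q by auto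
      have "adjacent a b"
        using leaf_neighbours_adjacent[OF L ab] adj \<open>a \<noteq> b\<close> adjacent_commute by blast
      have "b \<notin> set p'" using paths(1) adj p by auto
      show False
      proof (cases "\<exists>z\<in>set p'. adjacent b z")
        case False
        then have "induced_path (b # p)"
          using paths(1) \<open>adjacent a b\<close> \<open>b \<notin> set p'\<close> adjacent_commute p by auto
        moreover have "induced_path q" using paths(2) q by simp
        ultimately have "b # p = q"
          by (rule unique) (use paths p q notin ab last in \<open>auto split: if_splits\<close>)
        then have "a \<in> set q'" using p q by auto
        then show False using paths(2) q adj by auto
      next
        case True
        then obtain z xs ys where z: "adjacent b z" "p' = xs @ z # ys"
          by (meson split_list)
        have zF: "z \<in> \<F>" using z paths p by auto
        show False
        proof (cases "xs = []")
          case True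
          then have "adjacent a z" using paths p z by simp
          \<comment> \<open>The triangle on \<open>a\<close>, \<open>b\<close>, \<open>z\<close> makes \<open>z\<close> contain the set shared by all neighbours of
            the leaf, so \<open>z\<close> is itself a neighbour of \<open>L\<close>: a chord of the first path.\<close>
          then have "a \<inter> b \<subseteq> z"
            using triangle_inter_subset ab zF z \<open>adjacent a b\<close> by blast
          moreover have "a \<inter> L = b \<inter> L"
            using leaf_neighbours[OF L ab] adj adjacent_commute by blast
          ultimately have "a \<inter> L \<subseteq> z" by blast
          moreover have "L \<noteq> z" "L \<in> \<F>" using notin p z L by (auto simp: leaf_of_def)
          ultimately have "adjacent L z"
            using zF adj card_member
            by (intro adjacentI[where C = "a \<inter> L"]) (auto simp: adjacent_def Int_commute)
          then show False using paths p z by auto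
        next
          case False
          \<comment> \<open>Two induced paths from \<open>a\<close> to \<open>z\<close> that avoid the leaf, only one of them through \<open>b\<close>.\<close>
          have "induced_path ((a # xs @ [z]) @ ys)" using paths p z by auto
          then have path: "induced_path (a # xs @ [z])"
            using induced_path_appendD1 by blast
          moreover have "induced_path [a, b, z]"
            using path False z \<open>adjacent a b\<close> by (cases xs) auto
          ultimately have "a # xs @ [z] = [a, b, z]"
            by (rule unique) (use paths p q notin ab z in auto)
          then have "b \<in> set xs" by (cases xs) auto
          then show False using \<open>b \<notin> set p'\<close> z by auto
        qed
      qed
    qed
    moreover have "induced_path p" "induced_path q" using paths p q by auto
    then have "hd p = hd q \<Longrightarrow> ?thesis"
      by (rule unique) (use paths notin last p q in auto)
    ultimately show ?thesis using p q by simp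
  qed
qed

text \<open>At an interior leaf, the two neighbours along the path would be joined by a chord.\<close>

lemma (in uniform_forest) induced_path_through_leaf:
  assumes "leaf_of \<F> L" "induced_path p" "set p \<subseteq> \<F>" "L \<in> set p"
  shows "L = hd p \<or> L = last p"
proof (rule ccontr)
  assume ends: "\<not> ?thesis"
  obtain xs ys where p: "p = xs @ L # ys" using split_list[OF assms(4)] by blast
  then have "xs \<noteq> []" "ys \<noteq> []" using ends by auto
  then obtain b F H c where "xs = b @ [F]" "ys = H # c"
    by (meson list.exhaust rev_exhaust)
  then have p: "p = b @ [F, L, H] @ c" using p by simp
  then have "induced_path (F # L # H # c)"
    using assms induced_path_appendD[of b "F # L # H # c"] by simp
  then show False
    using leaf_neighbours_adjacent[OF assms(1), of F H] assms(3) p adjacent_commute by auto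
qed

text \<open>Some vertex of the two paths is a leaf of the family formed by all their vertices. It is an end of both
  paths, and after a reversal it is their common start.\<close>

lemma induced_path_unique:
  assumes "uniform_forest \<F> n" "induced_path p" "induced_path q"
    "set p \<subseteq> \<F>" "set q \<subseteq> \<F>" "hd p = hd q" "last p = last q"
  shows "p = q"
  using assms
proof (induction "card \<F>" arbitrary: \<F> p q rule: less_induct)
  case less
  let ?U = "set p \<union> set q"
  interpret U: uniform_forest ?U n
    using less.prems uniform_forest.subfamily by blast
  have ne: "p \<noteq> []" "q \<noteq> []" using less.prems by auto
  obtain L where L: "leaf_of ?U L" using U.ex_leaf ne by auto
  then have "L \<in> ?U" by (simp add: leaf_of_def)
  have unique: "p' = q'" if "induced_path p'" "induced_path q'" "set p' \<subseteq> ?U - {L}" "set q' \<subseteq> ?U - {L}"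
    "hd p' = hd q'" "last p' = last q'" for p' q'
  proof -
    have "card (?U - {L}) < card \<F>"
      using \<open>L \<in> ?U\<close> less.prems uniform_forest.finite_family
      by (intro psubset_card_mono) blast+
    moreover have "uniform_forest (?U - {L}) n" by (intro U.subfamily) auto
    ultimately show ?thesis using less.hyps that by blast
  qed
  have "L = hd p \<or> L = last p"
    using U.induced_path_through_leaf[OF L, of p] U.induced_path_through_leaf[OF L, of q]
      less.prems \<open>L \<in> ?U\<close> by auto
  then show ?case
  proof
    assume hd: "L = hd p"
    then obtain p' q' where pq: "p = L # p'" "q = L # q'"
      using ne less.prems by (metis list.collapse)
    have "p' = q'"
      by (rule U.induced_paths_from_leaf_eq[OF L _ _ _ _ _ unique]) (use less.prems pq in auto)
    then show ?thesis using pq by simp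
  next
    assume last: "L = last p"
    then obtain p' q' where pq: "rev p = L # p'" "rev q = L # q'"
      using ne less.prems by (metis hd_rev list.collapse rev_is_Nil_conv)
    have paths: "induced_path (L # p')" "induced_path (L # q')" "last (L # p') = last (L # q')"
      using less.prems ne unfolding pq[symmetric] by (simp_all add: induced_path_rev last_rev)
    have "set (rev p) = insert L (set p')" "set (rev q) = insert L (set q')"
      unfolding pq by simp_all
    then have sub: "set p' \<subseteq> ?U" "set q' \<subseteq> ?U" by auto
    have "p' = q'"
      by (rule U.induced_paths_from_leaf_eq[OF L paths(1,2) sub paths(3) unique])
    then show ?thesis using pq by (metis rev_rev_ident)
  qed
qed

text \<open>A chord or a repeated vertex gives a shortcut, whose vertices form a subsequence.\<close>

lemma shortcut_free_walk_induced:
  assumes "successively adjacent c" "c \<noteq> []"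
    and "\<And>c'. subseq c' c \<Longrightarrow> c' \<noteq> [] \<Longrightarrow> hd c' = hd c \<Longrightarrow> last c' = last c \<Longrightarrow>
      successively adjacent c' \<Longrightarrow> c' = c"
  shows "induced_path c"
  using assms
proof (induction c rule: induced_path.induct)
  case (3 F G c)
  have "induced_path (G # c)"
  proof (rule "3.IH")
    show "successively adjacent (G # c)" "G # c \<noteq> []" using "3.prems" by auto
    fix c' assume c': "subseq c' (G # c)" "c' \<noteq> []" "hd c' = hd (G # c)"
      "last c' = last (G # c)" "successively adjacent c'"
    have "F # c' = F # G # c"
      by (rule "3.prems"(3)) (use c' "3.prems"(1) in \<open>auto simp: successively_Cons\<close>)
    then show "c' = G # c" by simp
  qed
  moreover have "H \<noteq> F \<and> \<not> adjacent F H" if H: "H \<in> set c" for H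
  proof -
    obtain xs ys where c: "c = xs @ H # ys" using split_list[OF H] by blast
    have walk: "successively adjacent (H # ys)"
      using "3.prems"(1) c by (simp add: successively_append_iff successively_Cons)
    have sub: "subseq (H # ys) (G # c)"
      using c by (intro list_emb_Cons) auto
    have "H \<noteq> F"
    proof
      assume "H = F"
      have "H # ys = F # G # c"
        by (rule "3.prems"(3)) (use walk sub c \<open>H = F\<close> in auto)
      then show False using c by simp
    qed
    moreover have "\<not> adjacent F H"
    proof
      assume "adjacent F H"
      have "F # H # ys = F # G # c"
        by (rule "3.prems"(3)) (use walk sub c \<open>adjacent F H\<close> in auto)
      then show False using c by simp
    qed
    ultimately show ?thesis by simp
  qed
  ultimately show ?case using "3.prems" by simp
qed auto

section \<open>The exchange property\<close>

lemma card_Diff_last_le_walk: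
  assumes "successively adjacent c" "c \<noteq> []" "\<forall>F\<in>set c. finite F"
  shows "card (hd c - last c) \<le> length c - 1"
  using assms
proof (induction c rule: induced_path.induct)
  case (3 F G c)
  let ?L = "last (G # c)"
  have fin: "finite F" "finite G" using "3.prems" by auto
  have "card (F - G) = 1"
    using "3.prems" card_Diff_subset_Int[of F G] fin by (auto simp: adjacent_def)
  moreover have "card (F - ?L) \<le> card ((F - G) \<union> (G - ?L))"
    using fin by (intro card_mono) auto
  moreover have "card ((F - G) \<union> (G - ?L)) \<le> card (F - G) + card (G - ?L)"
    by (rule card_Un_le)
  moreover have "card (G - ?L) \<le> length c" using 3 by simp
  ultimately show ?case by simp
qed auto

definition exchange :: "'v set set \<Rightarrow> bool" where
  "exchange \<F> \<longleftrightarrow>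
     (\<forall>F\<in>\<F>. \<forall>G\<in>\<F>. F \<noteq> G \<longrightarrow> (\<exists>x\<in>F - G. \<exists>y\<in>G - F. insert y (F - {x}) \<in> \<F>))"

lemma exchangeE:
  assumes "exchange \<F>" "F \<in> \<F>" "G \<in> \<F>" "F \<noteq> G"
  obtains x y where "x \<in> F" "x \<notin> G" "y \<in> G" "y \<notin> F" "insert y (F - {x}) \<in> \<F>"
  using assms unfolding exchange_def by blast

text \<open>Since the rest of the walk needs one step for each element to be removed, the first step must
  already bring \<open>F\<close> closer to \<open>G\<close>: it removes an element outside \<open>G\<close> and adds one of \<open>G\<close>.\<close>

lemma geodesic_first_step:
  assumes walk: "successively adjacent c" "hd c = F" "last c = G" "length c = Suc (card (F - G))"
    and fin: "\<forall>H\<in>set c. finite H" and "card (F - G) > 0"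
  shows "\<exists>x\<in>F - G. \<exists>y\<in>G - F. insert y (F - {x}) \<in> set c"
proof -
  obtain H c' where c: "c = F # H # c'"
    using walk \<open>card (F - G) > 0\<close> by (cases c rule: induced_path.cases) auto
  have fF: "finite F" and fH: "finite H" using fin c by auto
  have adj: "adjacent F H" using walk c by simp
  then have "card (F - H) = 1" "card (H - F) = 1"
    using card_Diff_subset_Int[of F H] card_Diff_subset_Int[of H F] fF fH
    by (auto simp: adjacent_def Int_commute)
  then obtain x y where x: "F - H = {x}" and y: "H - F = {y}"
    by (meson card_1_singletonE)
  then have H: "H = insert y (F - {x})" by blast
  have less: "card (H - G) < card (F - G)"
    using card_Diff_last_le_walk[of "H # c'"] walk c fin \<open>card (F - G) > 0\<close> by auto
  have "x \<notin> G"
  proof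
    assume "x \<in> G"
    then have "card (F - G) \<le> card (H - G)" using H fH by (intro card_mono) auto
    then show False using less by simp
  qed
  moreover have "y \<in> G"
  proof (rule ccontr)
    assume "y \<notin> G"
    then have "H - G = insert y (F - G - {x})" using H \<open>x \<notin> G\<close> by auto
    moreover have "y \<notin> F" "x \<in> F - G" using x y \<open>x \<notin> G\<close> by auto
    ultimately have "card (H - G) = card (F - G)"
      using fF card_Suc_Diff1[of "F - G" x] by simp
    then show False using less by simp
  qed
  moreover have "insert y (F - {x}) \<in> set c" using c by (simp add: H[symmetric])
  ultimately show ?thesis using x y by blast
qed

text \<open>An exchange between two sets uses only elements of their union.\<close>

lemma exchange_disjoint:
  assumes "exchange \<F>"
  shows "exchange {G \<in> \<F>. F \<inter> G = {}}"
  unfolding exchange_def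
proof (intro ballI impI)
  fix G H assume GH: "G \<in> {G \<in> \<F>. F \<inter> G = {}}" "H \<in> {G \<in> \<F>. F \<inter> G = {}}" "G \<noteq> H"
  then obtain x y where "x \<in> G" "x \<notin> H" "y \<in> H" "y \<notin> G" "insert y (G - {x}) \<in> \<F>"
    using exchangeE[OF assms, of G H] by blast
  then show "\<exists>x\<in>G - H. \<exists>y\<in>H - G. insert y (G - {x}) \<in> {G \<in> \<F>. F \<inter> G = {}}"
    using GH by (intro bexI[of _ x] bexI[of _ y]) auto
qed

lemma (in uniform_forest) swap_adjacent:
  assumes "F \<in> \<F>" "x \<in> F" "y \<notin> F" "insert y (F - {x}) \<in> \<F>"
  shows "adjacent (insert y (F - {x})) F"
proof -
  have "insert y (F - {x}) \<inter> F = F - {x}" using assms by auto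
  moreover have "Suc (card (F - {x})) = n"
    using assms card_Suc_Diff1 finite_member card_member by metis
  ultimately show ?thesis
    using assms card_member by (simp add: adjacent_def)
qed

text \<open>The exchange never passes through a leaf: if the step from \<open>F\<close> towards \<open>G\<close> ended in \<open>L\<close>, then the next step
  from \<open>L\<close> towards \<open>G\<close> would remove the only vertex of \<open>L\<close> that is not shared with its neighbours, and this
  is the vertex of \<open>G\<close> that was just added, whereas an exchange towards \<open>G\<close> keeps all vertices of \<open>G\<close>.\<close>

lemma (in uniform_forest) exchange_remove_leaf:
  assumes "exchange \<F>" and L: "leaf_of \<F> L"
  shows "exchange (\<F> - {L})"
  unfolding exchange_def
proof (intro ballI impI)
  fix F G assume FG: "F \<in> \<F> - {L}" "G \<in> \<F> - {L}" "F \<noteq> G"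
  then obtain x y where xy: "x \<in> F - G" "y \<in> G - F" and step: "insert y (F - {x}) \<in> \<F>"
    using exchangeE[OF assms(1), of F G] by blast
  have "insert y (F - {x}) \<noteq> L"
  proof
    assume FL: "insert y (F - {x}) = L"
    have LF: "L \<in> \<F>" using L by (simp add: leaf_of_def)
    obtain x' y' where xy': "x' \<in> L - G" "y' \<in> G - L" and step': "insert y' (L - {x'}) \<in> \<F>"
      using exchangeE[OF assms(1), of L G] FG LF by blast
    let ?H = "insert y' (L - {x'})"
    have "adjacent F L"
      using swap_adjacent[of F x y] FG(1) xy step FL adjacent_commute by auto
    moreover have "adjacent ?H L"
      using swap_adjacent[of L x' y'] LF xy' step' by auto
    ultimately have "F \<inter> L = ?H \<inter> L"
      using leaf_neighbours[OF L] FG step' by blast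
    moreover have "y \<in> ?H" "y \<in> L" "y \<notin> F" using FL xy xy' by auto
    ultimately show False by blast
  qed
  then show "\<exists>x\<in>F - G. \<exists>y\<in>G - F. insert y (F - {x}) \<in> \<F> - {L}"
    using xy step by blast
qed

section \<open>Linear quotient orders\<close>

text \<open>This is the condition for the squarefree monomials of the listed sets, in this order, to have
  colon ideals generated by variables. It forces the sets in the list to be distinct.\<close>

definition linear_quotient_order :: "'v set list \<Rightarrow> bool" where
  "linear_quotient_order us \<longleftrightarrow>
     (\<forall>j<length us. \<forall>W\<in>set (take j us). \<exists>W'\<in>set (take j us). \<exists>y\<in>W - us ! j. W' - us ! j = {y})"

lemma linear_quotient_order_Nil [simp]: "linear_quotient_order []"
  by (simp add: linear_quotient_order_def)

lemma linear_quotient_orderE: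
  assumes "linear_quotient_order us" "j < length us" "W \<in> set (take j us)"
  obtains W' y where "W' \<in> set (take j us)" "y \<in> W - us ! j" "W' - us ! j = {y}"
proof -
  have "\<exists>W'\<in>set (take j us). \<exists>y\<in>W - us ! j. W' - us ! j = {y}"
    using assms(1)[unfolded linear_quotient_order_def, rule_format, OF assms(2,3)] .
  then show thesis using that by blast
qed

lemma linear_quotient_order_append:
  assumes us: "linear_quotient_order us"
    and vs: "\<And>j W. j < length vs \<Longrightarrow> W \<in> set us \<union> set (take j vs) \<Longrightarrow>
      \<exists>W'\<in>set us \<union> set (take j vs). \<exists>y\<in>W - vs ! j. W' - vs ! j = {y}"
  shows "linear_quotient_order (us @ vs)"
  unfolding linear_quotient_order_def
proof (intro allI impI)
  fix j assume j: "j < length (us @ vs)"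
  show "\<forall>W\<in>set (take j (us @ vs)). \<exists>W'\<in>set (take j (us @ vs)).
          \<exists>y\<in>W - (us @ vs) ! j. W' - (us @ vs) ! j = {y}"
  proof (cases "j < length us")
    case True
    then show ?thesis using us by (simp add: linear_quotient_order_def nth_append)
  next
    case False
    then show ?thesis using vs[of "j - length us"] j by (simp add: nth_append)
  qed
qed

text \<open>A leaf is appended to an order of the remaining sets. The exchange property of the whole family provides
  what the new set needs.\<close>

lemma ex_linear_quotient_order:
  assumes "uniform_forest \<F> n" "exchange \<F>"
  shows "\<exists>us. set us = \<F> \<and> linear_quotient_order us"
  using assms
proof (induction "card \<F>" arbitrary: \<F>)
  case 0
  then show ?case using uniform_forest.finite_family by (metis card_0_eq empty_set linear_quotient_order_Nil)
next
  case (Suc k)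
  then interpret uniform_forest \<F> n by simp
  obtain L where L: "leaf_of \<F> L" using ex_leaf Suc by fastforce
  then have "L \<in> \<F>" by (simp add: leaf_of_def)
  then have "k = card (\<F> - {L})" using Suc.hyps finite_family by simp
  then obtain us where us: "set us = \<F> - {L}" "linear_quotient_order us"
    using Suc.hyps(1)[of "\<F> - {L}"] subfamily[of "\<F> - {L}"] exchange_remove_leaf[OF Suc.prems(2) L]
    by auto
  have "linear_quotient_order (us @ [L])"
  proof (rule linear_quotient_order_append[OF us(2)])
    fix j W assume "j < length [L]" and W: "W \<in> set us \<union> set (take j [L])"
    then have j: "j = 0" and "W \<in> \<F>" "W \<noteq> L" using us by auto
    then obtain x y where xy: "x \<in> L - W" "y \<in> W - L" "insert y (L - {x}) \<in> \<F>"
      using exchangeE[OF Suc.prems(2), of L W] \<open>L \<in> \<F>\<close> by blast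
    then show "\<exists>W'\<in>set us \<union> set (take j [L]). \<exists>y\<in>W - [L] ! j. W' - [L] ! j = {y}"
      using us j by (intro bexI[of _ "insert y (L - {x})"] bexI[of _ y]) auto
  qed
  then show ?case using us \<open>L \<in> \<F>\<close> by (intro exI[of _ "us @ [L]"]) auto
qed

definition disjoint_unions :: "'v set set \<Rightarrow> 'v set set" where
  "disjoint_unions \<F> = {F \<union> G | F G. F \<in> \<F> \<and> G \<in> \<F> \<and> F \<inter> G = {}}"

text \<open>The three pairwise intersections contain \<open>y1\<close>, \<open>y2\<close> and \<open>a\<close> respectively, and each of these vertices is
  missing from the third set. So no intersection contains another one, and none of the three sets is a leaf.\<close>

lemma (in uniform_forest) no_special_triangle:
  assumes "K1 \<in> \<F>" "K2 \<in> \<F>" "G \<in> \<F>"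
    and "y1 \<in> K1 \<inter> G - K2" "y2 \<in> K2 \<inter> G - K1" "a \<in> K1 \<inter> K2 - G"
  shows False
proof -
  have "{K1, K2, G} \<subseteq> \<F>" using assms by simp
  then obtain L where "leaf_of {K1, K2, G} L" using ex_leaf by blast
  moreover have "K1 \<noteq> K2" "G \<noteq> K1" "G \<noteq> K2" using assms by auto
  ultimately show False using assms unfolding leaf_of_def by blast
qed

text \<open>For \<open>n > 0\<close> a leaf is not disjoint from itself, so the unions that involve the leaf \<open>L\<close> are the
  \<open>L \<union> G\<close> with \<open>G\<close> disjoint from \<open>L\<close>.
  They come after all others.\<close>

lemma ex_linear_quotient_order_disjoint_unions:
  assumes "uniform_forest \<F> n" "exchange \<F>" "n > 0"
  shows "\<exists>us. set us = disjoint_unions \<F> \<and> linear_quotient_order us"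
  using assms
proof (induction "card \<F>" arbitrary: \<F>)
  case 0
  then have "\<F> = {}" using uniform_forest.finite_family by (metis card_0_eq)
  then show ?case by (intro exI[of _ "[]"]) (simp add: disjoint_unions_def)
next
  case (Suc k)
  then interpret uniform_forest \<F> n by simp
  obtain L where L: "leaf_of \<F> L" using ex_leaf Suc by fastforce
  then have LF: "L \<in> \<F>" by (simp add: leaf_of_def)
  let ?\<F>' = "\<F> - {L}" and ?\<G> = "{G \<in> \<F>. L \<inter> G = {}}"
  have "L \<noteq> {}" using card_member[OF LF] \<open>n > 0\<close> by auto
  have "k = card ?\<F>'" using LF Suc.hyps finite_family by simp
  then obtain us where us: "set us = disjoint_unions ?\<F>'" "linear_quotient_order us"
    using Suc.hyps(1)[of ?\<F>'] subfamily[of ?\<F>'] exchange_remove_leaf[OF Suc.prems(2) L] \<open>n > 0\<close>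
    by auto
  obtain gs where gs: "set gs = ?\<G>" "linear_quotient_order gs"
    using ex_linear_quotient_order[OF subfamily exchange_disjoint[OF Suc.prems(2)], of L] by blast
  let ?vs = "map (\<lambda>G. L \<union> G) gs"
  have step: "\<exists>x\<in>L - H. \<exists>y\<in>H - L. insert y (L - {x}) \<in> ?\<F>'" if HF: "H \<in> ?\<F>'" for H
  proof -
    obtain x y where "x \<in> L" "x \<notin> H" "y \<in> H" "y \<notin> L" "insert y (L - {x}) \<in> \<F>"
      using exchangeE[OF Suc.prems(2) LF, of H] HF by auto
    moreover from \<open>y \<notin> L\<close> have "insert y (L - {x}) \<noteq> L" by auto
    ultimately show ?thesis by (intro bexI[of _ x] bexI[of _ y]) simp_all
  qed
  have "linear_quotient_order (us @ ?vs)"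
  proof (rule linear_quotient_order_append[OF us(2)])
    fix j W assume "j < length ?vs" and W: "W \<in> set us \<union> set (take j ?vs)"
    then have j: "j < length gs" by simp
    define G where "G = gs ! j"
    have G: "G \<in> \<F>" "L \<inter> G = {}" using gs(1) j nth_mem unfolding G_def by blast+
    have vsj: "?vs ! j = L \<union> G" using j by (simp add: G_def)
    have "\<exists>W'\<in>set us \<union> set (take j ?vs). \<exists>y\<in>W - (L \<union> G). W' - (L \<union> G) = {y}"
    proof (cases "W \<in> set us")
      case False
      then obtain G1 where G1: "G1 \<in> set (take j gs)" "W = L \<union> G1"
        using W by (auto simp: take_map)
      then obtain G2 y where G2: "G2 \<in> set (take j gs)" "y \<in> G1 - G" "G2 - G = {y}"
        using linear_quotient_orderE[OF gs(2) j G1(1)] unfolding G_def by auto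
      have "y \<notin> L" using G1(1) G2(2) gs(1) set_take_subset[of j gs] by blast
      then have "y \<in> W - (L \<union> G)" "(L \<union> G2) - (L \<union> G) = {y}" using G1 G2 by auto
      then show ?thesis using G2(1)
        by (intro bexI[of _ "L \<union> G2"] bexI[of _ y]) (auto simp: take_map)
    next
      case True
      then obtain H1 H2 where H: "H1 \<in> ?\<F>'" "H2 \<in> ?\<F>'" "H1 \<inter> H2 = {}" "W = H1 \<union> H2"
        using us by (auto simp: disjoint_unions_def)
      obtain x1 y1 where s1: "x1 \<in> L" "y1 \<in> H1 - L" "insert y1 (L - {x1}) \<in> ?\<F>'"
        using step[OF H(1)] by blast
      obtain x2 y2 where s2: "x2 \<in> L" "y2 \<in> H2 - L" "insert y2 (L - {x2}) \<in> ?\<F>'"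
        using step[OF H(2)] by blast
      \<comment> \<open>Exchanging one vertex of \<open>L\<close> gives an earlier union, as long as the new vertex is not in \<open>G\<close>.\<close>
      have swap: ?thesis if "x \<in> L" "y \<in> W - L" "insert y (L - {x}) \<in> ?\<F>'" "y \<notin> G" for x y
      proof -
        let ?K = "insert y (L - {x})"
        have "G \<in> ?\<F>'" "?K \<inter> G = {}" using G that \<open>L \<noteq> {}\<close> by auto
        then have "?K \<union> G \<in> set us"
          unfolding us disjoint_unions_def using that(3) by blast
        moreover have "(?K \<union> G) - (L \<union> G) = {y}" "y \<in> W - (L \<union> G)" using that by auto
        ultimately show ?thesis by blast
      qed
      show ?thesis
      proof (cases "y1 \<in> G \<and> y2 \<in> G")
        case False
        then show ?thesis using swap s1 s2 H(4) by blast
      next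
        case True
        have "y1 \<noteq> y2" using s1 s2 H(3) by blast
        have "adjacent (insert y1 (L - {x1})) L" "adjacent (insert y2 (L - {x2})) L"
          using swap_adjacent LF s1 s2 by auto
        then have "insert y1 (L - {x1}) \<inter> L = insert y2 (L - {x2}) \<inter> L"
          using leaf_neighbours[OF L] s1 s2 by blast
        moreover have "insert y1 (L - {x1}) \<inter> L = L - {x1}" "insert y2 (L - {x2}) \<inter> L = L - {x2}"
          using s1(2) s2(2) by auto
        ultimately have "L - {x1} = L - {x2}" by simp
        then have "x1 = x2" using s1(1) by auto
        \<comment> \<open>Two vertices in \<open>G\<close> mean \<open>n \<ge> 2\<close>, so the common part \<open>L - {x1}\<close> of the two new facets has an element.\<close>
        have "card {y1, y2} \<le> card G"
          using True finite_member[OF G(1)] by (intro card_mono) auto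
        then have "card (L - {x1}) > 0"
          using card_Diff_singleton[OF s1(1)] card_member[OF G(1)] card_member[OF LF] \<open>y1 \<noteq> y2\<close> by simp
        then obtain a where a: "a \<in> L - {x1}" by (metis card_gt_0_iff equals0I)
        have "a \<notin> G" using a G(2) by auto
        have False
        proof (rule no_special_triangle)
          show "insert y1 (L - {x1}) \<in> \<F>" "insert y2 (L - {x2}) \<in> \<F>" "G \<in> \<F>"
            using s1(3) s2(3) G(1) by simp_all
          show "y1 \<in> insert y1 (L - {x1}) \<inter> G - insert y2 (L - {x2})"
            "y2 \<in> insert y2 (L - {x2}) \<inter> G - insert y1 (L - {x1})"
            using True s1(2) s2(2) \<open>y1 \<noteq> y2\<close> by simp_all
          show "a \<in> insert y1 (L - {x1}) \<inter> insert y2 (L - {x2}) - G"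
            using a \<open>a \<notin> G\<close> \<open>x1 = x2\<close> by simp
        qed
        then show ?thesis ..
      qed
    qed
    then show "\<exists>W'\<in>set us \<union> set (take j ?vs). \<exists>y\<in>W - ?vs ! j. W' - ?vs ! j = {y}"
      unfolding vsj .
  qed
  moreover have "set (us @ ?vs) = disjoint_unions \<F>"
  proof -
    have "disjoint_unions \<F> = disjoint_unions ?\<F>' \<union> (\<lambda>G. L \<union> G) ` ?\<G>"
    proof
      show "disjoint_unions \<F> \<subseteq> disjoint_unions ?\<F>' \<union> (\<lambda>G. L \<union> G) ` ?\<G>"
      proof
        fix U assume "U \<in> disjoint_unions \<F>"
        then obtain F G where U: "U = F \<union> G" "F \<in> \<F>" "G \<in> \<F>" "F \<inter> G = {}"
          by (auto simp: disjoint_unions_def)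
        show "U \<in> disjoint_unions ?\<F>' \<union> (\<lambda>G. L \<union> G) ` ?\<G>"
        proof (cases "F = L \<or> G = L")
          case True
          then show ?thesis using U by (auto simp: Un_commute Int_commute)
        next
          case False
          then show ?thesis using U by (auto simp: disjoint_unions_def)
        qed
      qed
    qed (use LF in \<open>auto simp: disjoint_unions_def\<close>)
    then show ?thesis using us gs by simp
  qed
  ultimately show ?case by blast
qed

section \<open>Facets of a simplicial tree\<close>

lemma facets_eq_generating_antichain:
  assumes "\<G> \<subseteq> facets \<Delta>"
  shows "facets {G. \<exists>F\<in>\<G>. G \<subseteq> F} = \<G>"
  using assms unfolding facets_def by blast

text \<open>A subfamily of the facets is the set of facets of the complex that it generates, which is a subcollection.\<close>

lemma uniform_forest_facets:
  assumes tree: "simplicial_tree V \<Delta>" and pure: "pure_of_dim \<Delta> d"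
  shows "uniform_forest (facets \<Delta>) (nat (d + 1))"
proof
  have complex: "simplicial_complex V \<Delta>" using tree by (simp add: simplicial_tree_def)
  then have sub: "facets \<Delta> \<subseteq> Pow V" and V: "finite V"
    by (auto simp: simplicial_complex_def facets_def)
  show "finite (facets \<Delta>)" using sub V by (meson finite_Pow_iff finite_subset)
  show "finite F" if "F \<in> facets \<Delta>" for F
    using that sub V by (meson PowD finite_subset subsetD)
  show "card F = nat (d + 1)" if "F \<in> facets \<Delta>" for F
    using that pure by (auto simp: pure_of_dim_def face_dim_def)
  show "\<exists>L. leaf_of \<G> L" if G: "\<G> \<subseteq> facets \<Delta>" "\<G> \<noteq> {}" for \<G>
  proof -
    let ?\<Delta>' = "{G. \<exists>F\<in>\<G>. G \<subseteq> F}"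
    have "simplicial_complex V ?\<Delta>'"
      unfolding simplicial_complex_def
    proof (intro conjI ballI allI impI)
      show "?\<Delta>' \<subseteq> Pow V" using G(1) sub by auto
      show "?\<Delta>' \<noteq> {}" using G(2) by auto
    qed (use V in auto)
    then have "subcollection V ?\<Delta>' \<Delta>"
      using G by (simp add: subcollection_def facets_eq_generating_antichain)
    then obtain L where "leaf ?\<Delta>' L" using tree by (auto simp: simplicial_tree_def)
    then have "leaf_of \<G> L"
      by (simp add: leaf_def leaf_of_def facets_eq_generating_antichain[OF G(1)])
    then show ?thesis ..
  qed
qed

lemma proper_chain_iff_walk:
  assumes "pure_of_dim \<Delta> d"
  shows "proper_chain \<Delta> F G c \<longleftrightarrow>
    c \<noteq> [] \<and> set c \<subseteq> facets \<Delta> \<and> hd c = F \<and> last c = G \<and> successively adjacent c"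
proof -
  have "face_dim (H \<inter> K) = face_dim K - 1 \<longleftrightarrow> adjacent H K"
    if "H \<in> facets \<Delta>" "K \<in> facets \<Delta>" for H K
  proof -
    have "face_dim H = d" "face_dim K = d" using that assms by (simp_all add: pure_of_dim_def)
    then show ?thesis by (auto simp: face_dim_def adjacent_def)
  qed
  then have "(\<forall>i. Suc i < length c \<longrightarrow> face_dim (c ! i \<inter> c ! Suc i) = face_dim (c ! Suc i) - 1) \<longleftrightarrow>
      successively adjacent c" if "set c \<subseteq> facets \<Delta>"
    using that nth_mem[of _ c] unfolding successively_conv_nth by (meson Suc_lessD subsetD)
  then show ?thesis unfolding proper_chain_def by blast
qed

text \<open>In a pure complex proper chains are walks in the adjacency graph, and irredundance forbids shortcuts.\<close>

lemma irredundant_chain_induced: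
  assumes pure: "pure_of_dim \<Delta> d" and c: "irredundant_proper_chain \<Delta> F G c"
  shows "induced_path c"
proof (rule shortcut_free_walk_induced)
  have walk: "proper_chain \<Delta> F G c" using c by (simp add: irredundant_proper_chain_def)
  then show "successively adjacent c" "c \<noteq> []"
    by (simp_all add: proper_chain_iff_walk[OF pure])
  fix c' assume c': "subseq c' c" "c' \<noteq> []" "hd c' = hd c" "last c' = last c"
    "successively adjacent c'"
  then have "set c' \<subseteq> set c" by (auto elim: list_emb_set)
  then have "proper_chain \<Delta> F G c'"
    using c' walk by (auto simp: proper_chain_iff_walk[OF pure])
  then show "c' = c" using c c'(1) by (auto simp: irredundant_proper_chain_def)
qed

text \<open>A shortest proper chain is irredundant.\<close>

lemma ex_irredundant_chain:
  assumes "proper_chain \<Delta> F G c"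
  shows "\<exists>c. irredundant_proper_chain \<Delta> F G c"
proof -
  obtain c where c: "proper_chain \<Delta> F G c"
    and least: "\<And>c'. proper_chain \<Delta> F G c' \<Longrightarrow> length c \<le> length c'"
    using assms exists_least_iff[of "\<lambda>k. \<exists>c. proper_chain \<Delta> F G c \<and> length c = k"]
    by (metis leI)
  have "c' = c" if "subseq c' c" "proper_chain \<Delta> F G c'" for c'
    using that least[of c'] list_emb_length[OF that(1)] by (intro subseq_same_length) auto
  then show ?thesis using c unfolding irredundant_proper_chain_def by blast
qed

text \<open>By uniqueness of the irredundant chain, the definite description in the distance denotes an actual
  chain.\<close>

lemma ex_chain_of_length_facet_dist:
  assumes tree: "simplicial_tree V \<Delta>" and pure: "pure_of_dim \<Delta> d"
    and conn: "connected_codim1 \<Delta>" and FG: "F \<in> facets \<Delta>" "G \<in> facets \<Delta>"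
  shows "\<exists>c. proper_chain \<Delta> F G c \<and> length c = Suc (facet_dist \<Delta> F G)"
proof -
  have "\<exists>!c. irredundant_proper_chain \<Delta> F G c"
  proof (rule ex_ex1I)
    have "face_dim F = face_dim G" using FG pure by (simp add: pure_of_dim_def)
    then show "\<exists>c. irredundant_proper_chain \<Delta> F G c"
      using conn FG ex_irredundant_chain unfolding connected_codim1_def by (metis order_refl)
    fix c c' assume c: "irredundant_proper_chain \<Delta> F G c" "irredundant_proper_chain \<Delta> F G c'"
    then have "proper_chain \<Delta> F G c" "proper_chain \<Delta> F G c'"
      by (simp_all add: irredundant_proper_chain_def)
    then show "c = c'"
      using c induced_path_unique[OF uniform_forest_facets[OF tree pure]]
        irredundant_chain_induced[OF pure] unfolding proper_chain_def by metis
  qed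
  then have "irredundant_proper_chain \<Delta> F G (THE c. irredundant_proper_chain \<Delta> F G c)"
    by (rule theI')
  then have "proper_chain \<Delta> F G (THE c. irredundant_proper_chain \<Delta> F G c)"
    by (simp add: irredundant_proper_chain_def)
  moreover from this have "(THE c. irredundant_proper_chain \<Delta> F G c) \<noteq> []"
    by (simp add: proper_chain_def)
  ultimately show ?thesis
    unfolding facet_dist_def by (metis Suc_diff_1 length_greater_0_conv)
qed

lemma exchange_facets:
  assumes tree: "simplicial_tree V \<Delta>" and pure: "pure_of_dim \<Delta> d" and conn: "connected_codim1 \<Delta>"
    and dist: "\<And>F G k. F \<in> facets \<Delta> \<Longrightarrow> G \<in> facets \<Delta> \<Longrightarrow> k \<in> {1..d + 1} \<Longrightarrow>
      face_dim (F \<inter> G) = d - k \<Longrightarrow> int (facet_dist \<Delta> F G) = k"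
  shows "exchange (facets \<Delta>)"
  unfolding exchange_def
proof (intro ballI impI)
  fix F G assume FG: "F \<in> facets \<Delta>" "G \<in> facets \<Delta>" "F \<noteq> G"
  interpret uniform_forest "facets \<Delta>" "nat (d + 1)"
    by (rule uniform_forest_facets[OF tree pure])
  have dim: "face_dim F = d" using pure FG by (simp add: pure_of_dim_def)
  have "card (F \<inter> G) < nat (d + 1)" using card_Int_less FG by blast
  moreover have card: "card (F - G) = card F - card (F \<inter> G)"
    by (rule card_Diff_subset_Int) (use FG finite_member in auto)
  ultimately have pos: "card (F - G) > 0" using card_member FG by simp
  have "card (F \<inter> G) \<le> card F" using FG finite_member by (intro card_mono) auto
  then have "face_dim (F \<inter> G) = d - int (card (F - G))"
    using dim card by (simp add: face_dim_def)
  moreover have "int (card (F - G)) \<in> {1..d + 1}"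
    using pos card dim by (auto simp: face_dim_def)
  ultimately have "facet_dist \<Delta> F G = card (F - G)"
    using dist[OF FG(1,2)] by (metis of_nat_eq_iff)
  then obtain c where "proper_chain \<Delta> F G c" "length c = Suc (card (F - G))"
    using ex_chain_of_length_facet_dist[OF tree pure conn FG(1,2)] by auto
  then have "set c \<subseteq> facets \<Delta>" "\<exists>x\<in>F - G. \<exists>y\<in>G - F. insert y (F - {x}) \<in> set c"
    using geodesic_first_step[of c F G] pos finite_member
    by (auto simp: proper_chain_iff_walk[OF pure])
  then show "\<exists>x\<in>F - G. \<exists>y\<in>G - F. insert y (F - {x}) \<in> facets \<Delta>"
    by blast
qed

section \<open>Ideals generated by monomials\<close>

abbreviation monom :: "('v \<Rightarrow>\<^sub>0 nat) \<Rightarrow> ('v, 'k::field) mpoly" where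
  "monom m \<equiv> Poly_Mapping.single m 1"

abbreviation "lookup \<equiv> Poly_Mapping.lookup"

abbreviation "keys \<equiv> Poly_Mapping.keys"

definition exp_le :: "('v \<Rightarrow>\<^sub>0 nat) \<Rightarrow> ('v \<Rightarrow>\<^sub>0 nat) \<Rightarrow> bool" where
  "exp_le u m \<longleftrightarrow> (\<forall>v. lookup u v \<le> lookup m v)"

lemma exp_le_refl [simp]: "exp_le u u"
  by (simp add: exp_le_def)

lemma exp_le_trans: "exp_le u w \<Longrightarrow> exp_le w m \<Longrightarrow> exp_le u m"
  unfolding exp_le_def using order_trans by blast

lemma exp_le_antisym: "exp_le u w \<Longrightarrow> exp_le w u \<Longrightarrow> u = w"
  unfolding exp_le_def by (intro poly_mapping_eqI) (meson order_antisym)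

lemma exp_le_add: "exp_le u u' \<Longrightarrow> exp_le w w' \<Longrightarrow> exp_le (u + w) (u' + w')"
  by (simp add: exp_le_def lookup_add add_mono)

lemma exp_le_imp_eq_add: "exp_le u m \<Longrightarrow> m = u + (m - u)"
  by (rule poly_mapping_eqI) (simp add: exp_le_def lookup_add lookup_minus)

lemma poly_ring_simps [simp]:
  "p \<oplus>\<^bsub>poly_ring V\<^esub> q = p + q" "p \<otimes>\<^bsub>poly_ring V\<^esub> q = p * q"
  "\<one>\<^bsub>poly_ring V\<^esub> = 1" "\<zero>\<^bsub>poly_ring V\<^esub> = 0"
  by (simp_all add: poly_ring_def)

lemma mem_carrier_poly_ring:
  "p \<in> carrier (poly_ring V) \<longleftrightarrow> (\<forall>m\<in>keys p. keys m \<subseteq> V)"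
  by (simp add: poly_ring_def)

lemma monom_in_carrier [simp]:
  "(monom m :: ('v, 'k::field) mpoly) \<in> carrier (poly_ring V) \<longleftrightarrow> keys m \<subseteq> V"
  by (simp add: mem_carrier_poly_ring)

lemma ring_poly_ring: "ring (poly_ring V :: ('v, 'k::field) mpoly ring)"
  by (rule cring.axioms(1)[OF cring_poly_ring])

lemma keys_add_nat: "keys (m + m' :: 'v \<Rightarrow>\<^sub>0 nat) = keys m \<union> keys m'"
  by (auto simp: in_keys_iff lookup_add)

text \<open>Membership in an ideal generated by monomials is decided term by term: each exponent that occurs must be
  divisible by a generator. The polynomials with this property form an ideal; \<open>monomial_ideal_eq\<close> identifies
  it as the one generated by these monomials.\<close>

lemma monomial_ideal_is_ideal:
  fixes V :: "'v set" and N :: "('v \<Rightarrow>\<^sub>0 nat) set"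
  shows "ideal {p \<in> carrier (poly_ring V). \<forall>m\<in>keys p. \<exists>u\<in>N. exp_le u m}
    (poly_ring V :: ('v, 'k::field) mpoly ring)"
proof -
  let ?R = "poly_ring V :: ('v, 'k) mpoly ring"
  let ?I = "{p \<in> carrier ?R. \<forall>m\<in>keys p. \<exists>u\<in>N. exp_le u m}"
  interpret ring ?R by (rule ring_poly_ring)
  have absorb: "q * p \<in> ?I" if p: "p \<in> ?I" and q: "q \<in> carrier ?R" for p q
  proof -
    have "q * p \<in> carrier ?R" using p q m_closed[of q p] by simp
    moreover have "\<exists>u\<in>N. exp_le u m" if m: "m \<in> keys (q * p)" for m
    proof -
      obtain a b where ab: "b \<in> keys p" "m = a + b"
        using m Poly_Mapping.keys_mult[of q p] by blast
      then obtain u where "u \<in> N" "exp_le u b" using p by blast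
      then show ?thesis using ab by (intro bexI[of _ u]) (auto simp: exp_le_def lookup_add trans_le_add2)
    qed
    ultimately show ?thesis by blast
  qed
  have add: "p + q \<in> ?I" if "p \<in> ?I" "q \<in> ?I" for p q
  proof -
    have "p + q \<in> carrier ?R" using that a_closed[of p q] by simp
    then show ?thesis using that Poly_Mapping.keys_add[of p q] by blast
  qed
  have "(- 1 :: ('v, 'k) mpoly) \<in> carrier ?R" by (simp add: mem_carrier_poly_ring)
  show ?thesis
  proof (rule idealI[OF ring_poly_ring])
    show "subgroup ?I (add_monoid ?R)"
    proof (rule add.subgroupI)
      show "?I \<noteq> {}" using zero_closed by (intro ex_in_conv[THEN iffD1] exI[of _ 0]) simp
      show "\<ominus>\<^bsub>?R\<^esub> p \<in> ?I" if p: "p \<in> ?I" for p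
      proof -
        have pc: "p \<in> carrier ?R" using p by simp
        have "- p \<in> carrier ?R" using pc by (simp add: mem_carrier_poly_ring)
        moreover have "p + - p = 0" by simp
        ultimately have "\<ominus>\<^bsub>?R\<^esub> p = - p"
          using pc minus_equality[of "- p" p] by simp
        then show ?thesis using absorb[OF p \<open>- 1 \<in> carrier ?R\<close>] by simp
      qed
    next
      show "p \<oplus>\<^bsub>?R\<^esub> q \<in> ?I" if "p \<in> ?I" "q \<in> ?I" for p q
        using add[OF that] by simp
    qed blast
  next
    fix p q assume pq: "p \<in> ?I" "q \<in> carrier ?R"
    show "q \<otimes>\<^bsub>?R\<^esub> p \<in> ?I" using absorb[OF pq] by simp
    show "p \<otimes>\<^bsub>?R\<^esub> q \<in> ?I" using absorb[OF pq] by (simp add: mult.commute)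
  qed
qed

lemma monomial_ideal_eq:
  fixes V :: "'v set" and N :: "('v \<Rightarrow>\<^sub>0 nat) set"
  assumes N: "\<And>u. u \<in> N \<Longrightarrow> keys u \<subseteq> V"
  shows "Idl\<^bsub>poly_ring V\<^esub> ((monom :: _ \<Rightarrow> ('v, 'k::field) mpoly) ` N) =
    {p \<in> carrier (poly_ring V). \<forall>m\<in>keys p. \<exists>u\<in>N. exp_le u m}"
    (is "?J = ?I")
proof
  let ?R = "poly_ring V :: ('v, 'k) mpoly ring"
  interpret ring ?R by (rule ring_poly_ring)
  have carr: "monom ` N \<subseteq> carrier ?R" using N by auto
  have "monom ` N \<subseteq> ?I" using N by (fastforce intro: exp_le_refl)
  then show "?J \<subseteq> ?I" by (rule genideal_minimal[OF monomial_ideal_is_ideal])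
  interpret J: ideal ?J ?R by (rule genideal_ideal[OF carr])
  have multiple: "Poly_Mapping.single m c \<in> ?J" if m: "keys m \<subseteq> V" and u: "u \<in> N" "exp_le u m" for m c u
  proof -
    have m_eq: "m = u + (m - u)" by (rule exp_le_imp_eq_add[OF u(2)])
    then have "keys (m - u) \<subseteq> V" using m keys_add_nat[of u "m - u"] by simp
    then have "Poly_Mapping.single (m - u) c \<in> carrier ?R"
      by (simp add: mem_carrier_poly_ring)
    moreover have "monom u \<in> ?J" using genideal_self[OF carr] u(1) by blast
    ultimately have "monom u * Poly_Mapping.single (m - u) c \<in> ?J"
      using J.I_r_closed by fastforce
    then show ?thesis using m_eq by (simp add: mult_single)
  qed
  show "?I \<subseteq> ?J"
  proof
    fix p :: "('v, 'k) mpoly"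
    assume "p \<in> ?I"
    then have "\<forall>m\<in>keys p. keys m \<subseteq> V \<and> (\<exists>u\<in>N. exp_le u m)"
      by (auto simp: mem_carrier_poly_ring)
    then show "p \<in> ?J"
    proof (induction p rule: Poly_Mapping.update_induct)
      case const
      show ?case using J.zero_closed by simp
    next
      case (update f a b)
      have "Poly_Mapping.update a b f = f + Poly_Mapping.single a b"
        by (rule poly_mapping_eqI)
          (use update(1) in \<open>auto simp: lookup_update lookup_add lookup_single in_keys_iff\<close>)
      moreover have ks: "keys (Poly_Mapping.update a b f) = insert a (keys f)"
        using update(2) by (simp add: keys_update)
      then have "f \<in> ?J" using update by auto
      moreover have "Poly_Mapping.single a b \<in> ?J" using update.prems ks multiple by blast
      ultimately show ?case using J.a_closed by fastforce
    qed
  qed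
qed

lemma lookup_times_monom:
  "lookup ((p :: ('v, 'k::field) mpoly) * monom u) (m + u) = lookup p m"
proof -
  have "(\<Sum>q. lookup (monom u :: ('v, 'k) mpoly) q when m + u = l + q) = (1 when m = l)" for l
  proof -
    have "(\<lambda>q. lookup (monom u :: ('v, 'k) mpoly) q when m + u = l + q) =
        (\<lambda>q. (1 when m + u = l + q) when u = q)"
      by (auto simp: fun_eq_iff lookup_single when_def)
    then have "(\<Sum>q. lookup (monom u :: ('v, 'k) mpoly) q when m + u = l + q) =
        (\<Sum>q. (1 when m + u = l + q) when u = q)" by (rule arg_cong)
    then show ?thesis by simp
  qed
  then show ?thesis by (simp add: lookup_mult mult_when)
qed

lemma keys_times_monom:
  "keys ((p :: ('v, 'k::field) mpoly) * monom u) = (\<lambda>m. m + u) ` keys p"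
proof
  show "keys (p * monom u) \<subseteq> (\<lambda>m. m + u) ` keys p"
    using Poly_Mapping.keys_mult[of p "monom u"] by auto
  show "(\<lambda>m. m + u) ` keys p \<subseteq> keys (p * monom u)"
    by (auto simp: in_keys_iff lookup_times_monom)
qed

lemma colon_monomial_ideal:
  assumes N: "\<And>w. w \<in> N \<Longrightarrow> keys w \<subseteq> V" and u: "keys u \<subseteq> V"
  shows "colon_ideal V (Idl\<^bsub>poly_ring V\<^esub> ((monom :: _ \<Rightarrow> ('v, 'k::field) mpoly) ` N)) (monom u) =
    {p \<in> carrier (poly_ring V). \<forall>m\<in>keys p. \<exists>w\<in>N. exp_le w (m + u)}"
proof -
  interpret ring "poly_ring V :: ('v, 'k) mpoly ring" by (rule ring_poly_ring)
  have "p * monom u \<in> carrier (poly_ring V)" if "p \<in> carrier (poly_ring V)" for p :: "('v, 'k) mpoly"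
    using that u m_closed[of p "monom u"] by simp
  then show ?thesis
    by (auto simp: colon_ideal_def monomial_ideal_eq[OF N] keys_times_monom)
qed

lemma ideal_prod_monomial_ideals:
  fixes V :: "'v set" and N M :: "('v \<Rightarrow>\<^sub>0 nat) set"
  assumes N: "\<And>u. u \<in> N \<Longrightarrow> keys u \<subseteq> V" and M: "\<And>w. w \<in> M \<Longrightarrow> keys w \<subseteq> V"
  shows "ideal_prod (poly_ring V)
      (Idl\<^bsub>poly_ring V\<^esub> ((monom :: _ \<Rightarrow> ('v, 'k::field) mpoly) ` N))
      (Idl\<^bsub>poly_ring V\<^esub> ((monom :: _ \<Rightarrow> ('v, 'k) mpoly) ` M)) =
    Idl\<^bsub>poly_ring V\<^esub> (monom ` {u + w | u w. u \<in> N \<and> w \<in> M})"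
    (is "ideal_prod ?R ?I ?J = ?K")
proof
  interpret ring ?R by (rule ring_poly_ring)
  have cN: "monom ` N \<subseteq> carrier ?R" and cM: "monom ` M \<subseteq> carrier ?R" using N M by auto
  have I: "ideal ?I ?R" and J: "ideal ?J ?R" using cN cM by (simp_all add: genideal_ideal)
  have NM: "keys m \<subseteq> V" if "m \<in> {u + w | u w. u \<in> N \<and> w \<in> M}" for m
    using that by (auto simp: keys_add_nat dest: N[THEN subsetD] M[THEN subsetD])
  then have cNM: "monom ` {u + w | u w. u \<in> N \<and> w \<in> M} \<subseteq> carrier ?R"
    unfolding image_subset_iff monom_in_carrier by blast
  interpret K: ideal ?K ?R by (rule genideal_ideal[OF cNM])
  show "ideal_prod ?R ?I ?J \<subseteq> ?K"
  proof
    fix p assume "p \<in> ideal_prod ?R ?I ?J"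
    then show "p \<in> ?K"
    proof (induction rule: ideal_prod.induct)
      case (prod i j)
      have i: "i \<in> carrier ?R" "\<forall>m\<in>keys i. \<exists>u\<in>N. exp_le u m"
        and j: "j \<in> carrier ?R" "\<forall>m\<in>keys j. \<exists>u\<in>M. exp_le u m"
        using prod by (simp_all add: monomial_ideal_eq N M)
      have divides: "\<exists>u\<in>{u + w | u w. u \<in> N \<and> w \<in> M}. exp_le u m" if m: "m \<in> keys (i * j)" for m
      proof -
        obtain a b where ab: "a \<in> keys i" "b \<in> keys j" "m = a + b"
          using m Poly_Mapping.keys_mult[of i j] by blast
        then obtain u w where "u \<in> N" "exp_le u a" "w \<in> M" "exp_le w b" using i j by blast
        then show ?thesis using exp_le_add ab(3) by blast
      qed
      have "i \<otimes>\<^bsub>?R\<^esub> j \<in> carrier ?R" using i j by (intro m_closed)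
      then have "i * j \<in> {p \<in> carrier ?R. \<forall>m\<in>keys p.
          \<exists>u\<in>{u + w | u w. u \<in> N \<and> w \<in> M}. exp_le u m}"
        using divides by (intro CollectI conjI ballI) simp_all
      then show ?case
        by (subst monomial_ideal_eq[OF NM]) simp_all
    next
      case (sum s1 s2)
      then show ?case using K.a_closed by blast
    qed
  qed
  show "?K \<subseteq> ideal_prod ?R ?I ?J"
  proof (rule genideal_minimal[OF ideal_prod_is_ideal[OF I J]])
    show "monom ` {u + w | u w. u \<in> N \<and> w \<in> M} \<subseteq> ideal_prod ?R ?I ?J"
    proof clarify
      fix u w assume "u \<in> N" "w \<in> M"
      then have "monom u \<in> ?I" "monom w \<in> ?J"
        using genideal_self[OF cN] genideal_self[OF cM] by blast+
      then have "monom u \<otimes>\<^bsub>?R\<^esub> monom w \<in> ideal_prod ?R ?I ?J" by (rule ideal_prod.prod)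
      then show "monom (u + w) \<in> ideal_prod ?R ?I ?J" by (simp add: mult_single)
    qed
  qed
qed

lemma monom_eq_iff [simp]: "(monom u :: ('v, 'k::field) mpoly) = monom w \<longleftrightarrow> u = w"
  by (metis keys_single one_neq_zero singleton_inject)

text \<open>Monomials that do not divide each other are irredundant generators. Conversely, a member \<open>u\<close> of any minimal
  set of monomial generators is divisible by some \<open>w\<close> of the antichain, which is divisible by some \<open>u'\<close> of
  the minimal set; minimality gives \<open>u' = u\<close>, and so \<open>u = w\<close>.\<close>

lemma minimal_generators_antichain:
  fixes V :: "'v set" and N :: "('v \<Rightarrow>\<^sub>0 nat) set"
  assumes N: "\<And>u. u \<in> N \<Longrightarrow> keys u \<subseteq> V"
    and antichain: "\<And>u w. u \<in> N \<Longrightarrow> w \<in> N \<Longrightarrow> exp_le u w \<Longrightarrow> u = w"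
  shows "minimal_monomial_generators V (Idl\<^bsub>poly_ring V\<^esub> ((monom :: _ \<Rightarrow> ('v, 'k::field) mpoly) ` N)) =
    monom ` N"
proof -
  let ?Idl = "\<lambda>N. Idl\<^bsub>poly_ring V\<^esub> ((monom :: _ \<Rightarrow> ('v, 'k) mpoly) ` N)"
  have memI: "monom m \<in> ?Idl M" if "\<And>u. u \<in> M \<Longrightarrow> keys u \<subseteq> V" "m \<in> M" for M m
    using that by (auto simp: monomial_ideal_eq[OF that(1)] intro!: bexI[of _ m])
  have memD: "\<exists>u\<in>M. exp_le u m" if "\<And>u. u \<in> M \<Longrightarrow> keys u \<subseteq> V" "monom m \<in> ?Idl M" for M m
    using that(2) by (simp add: monomial_ideal_eq[OF that(1)])
  have "monom u \<in> minimal_monomial_generators V (?Idl N)" if u: "u \<in> N" for u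
  proof -
    have "Idl\<^bsub>poly_ring V\<^esub> M' \<noteq> ?Idl N" if sub: "M' \<subset> monom ` N" for M' :: "('v, 'k) mpoly set"
    proof
      assume eq: "Idl\<^bsub>poly_ring V\<^esub> M' = ?Idl N"
      obtain N' where N': "N' \<subseteq> N" "M' = monom ` N'"
        using psubset_imp_subset[OF sub] by (auto simp: subset_image_iff)
      then obtain w where w: "w \<in> N" "w \<notin> N'" using sub by blast
      have N'V: "keys m \<subseteq> V" if "m \<in> N'" for m using that N N'(1) by blast
      have "monom w \<in> ?Idl N'" using memI[OF N w(1)] eq N'(2) by simp
      then obtain w' where "w' \<in> N'" "exp_le w' w" using memD[OF N'V] by blast
      then show False using antichain N' w by blast
    qed
    moreover have "monom ` N \<subseteq> monomials V" using N by (auto simp: monomials_def)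
    ultimately show ?thesis using u unfolding minimal_monomial_generators_def by blast
  qed
  moreover have "p \<in> monom ` N" if p: "p \<in> minimal_monomial_generators V (?Idl N)" for p
  proof -
    obtain M where M: "M \<subseteq> monomials V" "Idl\<^bsub>poly_ring V\<^esub> M = ?Idl N" "p \<in> M"
      and min: "\<And>M'. M' \<subset> M \<Longrightarrow> Idl\<^bsub>poly_ring V\<^esub> M' \<noteq> ?Idl N"
      using p unfolding minimal_monomial_generators_def by blast
    define E where "E = {m. keys m \<subseteq> V \<and> monom m \<in> M}"
    have E: "M = monom ` E" using M(1) by (auto simp: E_def monomials_def)
    have EV: "keys m \<subseteq> V" if "m \<in> E" for m using that by (simp add: E_def)
    have eq: "?Idl E = ?Idl N" using M(2) E by simp
    obtain u where u: "u \<in> E" "p = monom u" using M(3) E by blast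
    have "monom u \<in> ?Idl N" using memI[OF EV u(1)] eq by simp
    then obtain w where w: "w \<in> N" "exp_le w u" using memD[OF N] by blast
    have "monom w \<in> ?Idl E" using memI[OF N w(1)] eq by simp
    then obtain u' where u': "u' \<in> E" "exp_le u' w" using memD[OF EV] by blast
    have "u' = u"
    proof (rule ccontr)
      assume "u' \<noteq> u"
      have le: "exp_le u' u" using u' w exp_le_trans by blast
      have "(\<exists>a\<in>E - {u}. exp_le a m) \<longleftrightarrow> (\<exists>a\<in>E. exp_le a m)" for m
        using le \<open>u' \<noteq> u\<close> u'(1) exp_le_trans by blast
      moreover have "?Idl (E - {u}) = {p \<in> carrier (poly_ring V). \<forall>m\<in>keys p. \<exists>a\<in>E - {u}. exp_le a m}"
        by (rule monomial_ideal_eq) (use EV in blast)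
      moreover have "?Idl E = {p \<in> carrier (poly_ring V). \<forall>m\<in>keys p. \<exists>a\<in>E. exp_le a m}"
        by (rule monomial_ideal_eq) (use EV in blast)
      ultimately have "?Idl (E - {u}) = ?Idl E" by simp
      moreover have "(monom u :: ('v, 'k) mpoly) \<notin> monom ` (E - {u})" by auto
      then have "monom ` (E - {u}) \<subset> M" using u E by blast
      ultimately show False using min eq by metis
    qed
    then have "u = w" using u' w exp_le_antisym by blast
    then show ?thesis using w u by blast
  qed
  ultimately show ?thesis by blast
qed

section \<open>Squarefree monomials and linear quotients\<close>

definition squarefree_exp :: "'v set \<Rightarrow> 'v \<Rightarrow>\<^sub>0 nat" where
  "squarefree_exp U = (\<Sum>v\<in>U. Poly_Mapping.single v 1)"

lemma lookup_squarefree_exp: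
  "finite U \<Longrightarrow> lookup (squarefree_exp U) v = (if v \<in> U then 1 else 0)"
  by (simp add: squarefree_exp_def lookup_sum lookup_single when_def)

lemma keys_squarefree_exp: "finite U \<Longrightarrow> keys (squarefree_exp U) = U"
  by (auto simp: in_keys_iff lookup_squarefree_exp split: if_splits)

lemma prod_var: "finite U \<Longrightarrow> (\<Prod>v\<in>U. var v :: ('v, 'k::field) mpoly) = monom (squarefree_exp U)"
  by (induction U rule: finite_induct) (simp_all add: squarefree_exp_def var_def mult_single)

lemma exp_le_squarefree_iff:
  assumes "finite W" "finite U"
  shows "exp_le (squarefree_exp W) (m + squarefree_exp U) \<longleftrightarrow> W - U \<subseteq> keys m"
  unfolding exp_le_def
  by (auto simp: lookup_add lookup_squarefree_exp assms in_keys_iff Suc_le_eq split: if_splits)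

lemma exp_le_single_iff: "exp_le (Poly_Mapping.single y 1) m \<longleftrightarrow> y \<in> keys m"
  by (auto simp: exp_le_def lookup_single when_def in_keys_iff Suc_le_eq)

text \<open>The colon ideal at a set \<open>U\<close> consists of the polynomials all of whose exponents contain \<open>W - U\<close> for an
  earlier \<open>W\<close>. The order condition says that the singletons among these \<open>W - U\<close> suffice, and they correspond
  to variables.\<close>

lemma linear_quotients_of_order:
  fixes V :: "'v set"
  assumes V: "finite V" "\<And>U. U \<in> set us \<Longrightarrow> U \<subseteq> V" and order: "linear_quotient_order us"
  shows "has_linear_quotients V
    (Idl\<^bsub>poly_ring V\<^esub> ((monom :: _ \<Rightarrow> ('v, 'k::field) mpoly) ` squarefree_exp ` set us))"
proof -
  let ?x = "\<lambda>U. monom (squarefree_exp U) :: ('v, 'k) mpoly"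
  let ?fs = "map ?x us"
  have fin: "finite U" if "U \<in> set us" for U using V that finite_subset by blast
  have keys: "keys (squarefree_exp U) \<subseteq> V" if "U \<in> set us" for U
    using V that fin by (simp add: keys_squarefree_exp)
  have forms: "\<exists>k. f \<in> forms V k" if "f \<in> set ?fs" for f
    using that keys by (auto simp: forms_def)
  have colon: "\<exists>L\<subseteq>forms V 1. colon_ideal V (Idl\<^bsub>poly_ring V\<^esub> (set (take i ?fs))) (?fs ! i) =
      Idl\<^bsub>poly_ring V\<^esub> L" if i: "i < length ?fs" for i
  proof -
    define U where "U = us ! i"
    define Y where "Y = {y. \<exists>W\<in>set (take i us). W - U = {y}}"
    have U: "U \<in> set us" using i by (simp add: U_def)
    have before: "W \<in> set us" if "W \<in> set (take i us)" for W using that by (rule in_set_takeD)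
    have YV: "Y \<subseteq> V" using V(2) before unfolding Y_def by blast
    have linear: "(var :: _ \<Rightarrow> ('v, 'k) mpoly) ` Y \<subseteq> forms V 1"
      using YV by (auto simp: forms_def var_def monomial_degree_def)
    have divides_iff: "(\<exists>w\<in>squarefree_exp ` set (take i us). exp_le w (m + squarefree_exp U)) \<longleftrightarrow>
        (\<exists>w\<in>(\<lambda>y. Poly_Mapping.single y 1) ` Y. exp_le w m)" for m
    proof
      assume "\<exists>w\<in>squarefree_exp ` set (take i us). exp_le w (m + squarefree_exp U)"
      then obtain W where W: "W \<in> set (take i us)" "W - U \<subseteq> keys m"
        using fin U before exp_le_squarefree_iff by (metis imageE)
      obtain W' y where "W' \<in> set (take i us)" "y \<in> W - U" "W' - U = {y}"
        using linear_quotient_orderE[OF order _ W(1)] i unfolding U_def by auto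
      then have "y \<in> Y" "y \<in> keys m" using W by (auto simp: Y_def)
      then have "y \<in> Y" "exp_le (Poly_Mapping.single y 1) m"
        by (simp_all only: exp_le_single_iff)
      then show "\<exists>w\<in>(\<lambda>y. Poly_Mapping.single y 1) ` Y. exp_le w m" by blast
    next
      assume "\<exists>w\<in>(\<lambda>y. Poly_Mapping.single y 1) ` Y. exp_le w m"
      then obtain y where y: "y \<in> Y" "y \<in> keys m" unfolding bex_simps exp_le_single_iff by blast
      then obtain W where W: "W \<in> set (take i us)" "W - U = {y}" by (auto simp: Y_def)
      then have "exp_le (squarefree_exp W) (m + squarefree_exp U)"
        using y fin U before by (simp add: exp_le_squarefree_iff)
      then show "\<exists>w\<in>squarefree_exp ` set (take i us). exp_le w (m + squarefree_exp U)"
        using W by blast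
    qed
    have var: "var = (\<lambda>y. monom (Poly_Mapping.single y 1) :: ('v, 'k) mpoly)"
      by (simp add: fun_eq_iff var_def)
    have "Idl\<^bsub>poly_ring V\<^esub> ((var :: _ \<Rightarrow> ('v, 'k) mpoly) ` Y) =
        Idl\<^bsub>poly_ring V\<^esub> (monom ` (\<lambda>y. Poly_Mapping.single y 1) ` Y)"
      unfolding var image_image ..
    also have "\<dots> = {p \<in> carrier (poly_ring V). \<forall>m\<in>keys p.
        \<exists>w\<in>(\<lambda>y. Poly_Mapping.single y 1) ` Y. exp_le w m}"
      by (rule monomial_ideal_eq) (use YV in auto)
    also have "\<dots> = colon_ideal V (Idl\<^bsub>poly_ring V\<^esub> (monom ` squarefree_exp ` set (take i us))) (?x U)"
      unfolding divides_iff[symmetric]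
      by (rule colon_monomial_ideal[symmetric]) (use keys before U in auto)
    also have "monom ` squarefree_exp ` set (take i us) = set (take i ?fs)"
      by (simp add: take_map image_image)
    also have "?x U = ?fs ! i" using i by (simp add: U_def)
    finally show ?thesis using linear by (intro exI[of _ "var ` Y"]) simp
  qed
  have "set ?fs = monom ` squarefree_exp ` set us" by (simp add: image_image)
  then show ?thesis
    unfolding has_linear_quotients_def using forms colon
    by (intro exI[of _ ?fs] conjI ballI allI impI) simp_all
qed

lemma facet_ideal_eq:
  assumes "\<And>F. F \<in> facets \<Delta> \<Longrightarrow> finite F"
  shows "(facet_ideal V \<Delta> :: ('v, 'k::field) mpoly set) =
    Idl\<^bsub>poly_ring V\<^esub> (monom ` squarefree_exp ` facets \<Delta>)"
  unfolding facet_ideal_def image_image using assms by (simp add: prod_var cong: image_cong)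

lemma ideal_square:
  assumes "ideal I (poly_ring V :: ('v, 'k::field) mpoly ring)"
  shows "I [^]\<^bsub>ideals_set (poly_ring V)\<^esub> (2::nat) = ideal_prod (poly_ring V) I I"
proof -
  interpret cring "poly_ring V :: ('v, 'k) mpoly ring" by (rule cring_poly_ring)
  interpret ideals: comm_monoid "ideals_set (poly_ring V :: ('v, 'k) mpoly ring)"
    by (rule ideals_set_is_comm_monoid)
  have "I \<in> carrier (ideals_set (poly_ring V))" using assms by (simp add: ideals_set_def)
  then show ?thesis
    by (simp add: numeral_2_eq_2) (simp add: ideals_set_def)
qed

text \<open>The products of two generators have the same degree \<open>2n\<close>, so none of them properly divides another one and all of
  them are minimal generators of the square. Such a product is squarefree exactly when the two sets are disjoint.\<close>

lemma squarefree_square_equigenerated: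
  fixes V :: "'v set"
  assumes V: "finite V" "\<And>F. F \<in> \<F> \<Longrightarrow> F \<subseteq> V" and card: "\<And>F. F \<in> \<F> \<Longrightarrow> card F = n"
  shows "squarefree_power V (Idl\<^bsub>poly_ring V\<^esub> ((monom :: _ \<Rightarrow> ('v, 'k::field) mpoly) ` squarefree_exp ` \<F>)) 2 =
    Idl\<^bsub>poly_ring V\<^esub> (monom ` squarefree_exp ` disjoint_unions \<F>)"
proof -
  let ?R = "poly_ring V :: ('v, 'k) mpoly ring"
  let ?P = "{squarefree_exp F + squarefree_exp G | F G. F \<in> \<F> \<and> G \<in> \<F>}"
  interpret ring ?R by (rule ring_poly_ring)
  have fin: "finite F" if "F \<in> \<F>" for F using V that finite_subset by blast
  have keys: "keys u \<subseteq> V" if "u \<in> squarefree_exp ` \<F>" for u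
    using that fin by (auto simp: keys_squarefree_exp dest: V(2)[THEN subsetD])
  have keysP: "keys u \<subseteq> V" if u: "u \<in> ?P" for u
  proof -
    obtain F G where FG: "F \<in> \<F>" "G \<in> \<F>" "u = squarefree_exp F + squarefree_exp G"
      using u by blast
    then show ?thesis using V(2) fin by (simp add: keys_add_nat keys_squarefree_exp)
  qed
  have "monom ` squarefree_exp ` \<F> \<subseteq> carrier ?R" using keys by auto
  then have "ideal (Idl\<^bsub>?R\<^esub> (monom ` squarefree_exp ` \<F>)) ?R" by (rule genideal_ideal)
  then have square: "Idl\<^bsub>?R\<^esub> (monom ` squarefree_exp ` \<F>) [^]\<^bsub>ideals_set ?R\<^esub> (2::nat) =
      Idl\<^bsub>?R\<^esub> (monom ` {u + w | u w. u \<in> squarefree_exp ` \<F> \<and> w \<in> squarefree_exp ` \<F>})"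
    by (simp only: ideal_square ideal_prod_monomial_ideals[OF keys keys])
  have P: "{u + w | u w. u \<in> squarefree_exp ` \<F> \<and> w \<in> squarefree_exp ` \<F>} = ?P" by blast
  have degree: "(\<Sum>v\<in>V. lookup u v) = n + n" if u: "u \<in> ?P" for u
  proof -
    obtain F G where FG: "F \<in> \<F>" "G \<in> \<F>" "u = squarefree_exp F + squarefree_exp G" using u by blast
    have "(\<Sum>v\<in>V. lookup (squarefree_exp H) v) = n" if "H \<in> \<F>" for H
      using that V card fin
      by (simp add: lookup_squarefree_exp sum.If_cases Int_absorb1)
    then show ?thesis using FG by (simp add: lookup_add sum.distrib)
  qed
  have antichain: "u = w" if uw: "u \<in> ?P" "w \<in> ?P" "exp_le u w" for u w
  proof (rule poly_mapping_eqI, rule ccontr)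
    fix v assume ne: "lookup u v \<noteq> lookup w v"
    then have "v \<in> V" using keysP[OF uw(1)] keysP[OF uw(2)] by (metis in_keys_iff subsetD)
    then have "(\<Sum>v\<in>V. lookup u v) < (\<Sum>v\<in>V. lookup w v)"
      using V(1) uw(3) ne by (intro sum_strict_mono_ex1) (auto simp: exp_le_def order_le_less)
    then show False using degree uw by simp
  qed
  have "squarefree_monomials V \<inter> (monom :: _ \<Rightarrow> ('v, 'k) mpoly) ` ?P =
      monom ` squarefree_exp ` disjoint_unions \<F>"
  proof -
    have sf: "(monom u :: ('v, 'k) mpoly) \<in> squarefree_monomials V \<longleftrightarrow> keys u \<subseteq> V \<and> (\<forall>v. lookup u v \<le> 1)" for u
      by (auto simp: squarefree_monomials_def)
    have disj: "(\<forall>v. lookup (squarefree_exp F + squarefree_exp G) v \<le> 1) \<longleftrightarrow> F \<inter> G = {}"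
      if "F \<in> \<F>" "G \<in> \<F>" for F G
      using that fin by (auto simp: lookup_add lookup_squarefree_exp)
    have add: "squarefree_exp F + squarefree_exp G = squarefree_exp (F \<union> G)"
      if "F \<in> \<F>" "G \<in> \<F>" "F \<inter> G = {}" for F G
      using that fin by (simp add: squarefree_exp_def sum.union_disjoint)
    have "squarefree_exp ` disjoint_unions \<F> = {u \<in> ?P. \<forall>v. lookup u v \<le> 1}"
    proof (intro subset_antisym subsetI)
      fix u assume "u \<in> squarefree_exp ` disjoint_unions \<F>"
      then obtain F G where FG: "F \<in> \<F>" "G \<in> \<F>" "F \<inter> G = {}" "u = squarefree_exp (F \<union> G)"
        by (auto simp: disjoint_unions_def)
      then show "u \<in> {u \<in> ?P. \<forall>v. lookup u v \<le> 1}"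
        using disj[OF FG(1,2)] add[OF FG(1-3)] by auto
    next
      fix u assume "u \<in> {u \<in> ?P. \<forall>v. lookup u v \<le> 1}"
      then obtain F G where FG: "F \<in> \<F>" "G \<in> \<F>" "u = squarefree_exp F + squarefree_exp G"
        and "\<forall>v. lookup u v \<le> 1" by blast
      then have "F \<inter> G = {}" using disj by blast
      then have "u = squarefree_exp (F \<union> G)" "F \<union> G \<in> disjoint_unions \<F>"
        using FG add by (auto simp: disjoint_unions_def)
      then show "u \<in> squarefree_exp ` disjoint_unions \<F>" by blast
    qed
    moreover have "squarefree_monomials V \<inter> (monom :: _ \<Rightarrow> ('v, 'k) mpoly) ` ?P =
        monom ` {u \<in> ?P. \<forall>v. lookup u v \<le> 1}"
    proof (intro subset_antisym subsetI)
      fix p :: "('v, 'k) mpoly"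
      assume p: "p \<in> squarefree_monomials V \<inter> monom ` ?P"
      then obtain u where u: "u \<in> ?P" "p = monom u" by (elim IntE imageE)
      then have "(monom u :: ('v, 'k) mpoly) \<in> squarefree_monomials V" using p by simp
      then have "\<forall>v. lookup u v \<le> 1" by (simp add: sf)
      then show "p \<in> monom ` {u \<in> ?P. \<forall>v. lookup u v \<le> 1}" using u by blast
    next
      fix p :: "('v, 'k) mpoly"
      assume "p \<in> monom ` {u \<in> ?P. \<forall>v. lookup u v \<le> 1}"
      then obtain u where "u \<in> ?P" "\<forall>v. lookup u v \<le> 1" "p = monom u" by blast
      then show "p \<in> squarefree_monomials V \<inter> monom ` ?P" using sf keysP by blast
    qed
    ultimately show ?thesis by simp
  qed
  moreover have "minimal_monomial_generators V (Idl\<^bsub>?R\<^esub> (monom ` ?P)) = monom ` ?P"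
    by (rule minimal_generators_antichain[OF keysP antichain])
  ultimately show ?thesis
    unfolding squarefree_power_def square P by simp
qed


theorem theorem2p2:
  fixes V :: "'v set" and \<Delta> :: "'v set set"
  assumes "simplicial_complex V \<Delta>"
    and "simplicial_tree V \<Delta>"
    and "intersection_property V \<Delta>"
  shows "has_linear_quotients V (facet_ideal V \<Delta> :: ('v, 'k::field) mpoly set) \<and>
         has_linear_quotients V (squarefree_power V (facet_ideal V \<Delta> :: ('v, 'k) mpoly set) 2)"
proof -
  obtain d where pure: "pure_of_dim \<Delta> d" and conn: "connected_codim1 \<Delta>"
    and dist: "\<And>F G k. F \<in> facets \<Delta> \<Longrightarrow> G \<in> facets \<Delta> \<Longrightarrow> k \<in> {1..d + 1} \<Longrightarrow>
      face_dim (F \<inter> G) = d - k \<Longrightarrow> int (facet_dist \<Delta> F G) = k"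
    using assms(3) unfolding intersection_property_def by blast
  let ?n = "nat (d + 1)"
  interpret uniform_forest "facets \<Delta>" ?n by (rule uniform_forest_facets[OF assms(2) pure])
  have exchange: "exchange (facets \<Delta>)" by (rule exchange_facets[OF assms(2) pure conn dist])
  have V: "finite V" "\<And>F. F \<in> facets \<Delta> \<Longrightarrow> F \<subseteq> V"
    using assms(1) by (auto simp: simplicial_complex_def facets_def)
  have ideal: "(facet_ideal V \<Delta> :: ('v, 'k) mpoly set) = Idl\<^bsub>poly_ring V\<^esub> (monom ` squarefree_exp ` facets \<Delta>)"
    by (rule facet_ideal_eq[OF finite_member])
  have square: "squarefree_power V (facet_ideal V \<Delta> :: ('v, 'k) mpoly set) 2 =
      Idl\<^bsub>poly_ring V\<^esub> (monom ` squarefree_exp ` disjoint_unions (facets \<Delta>))"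
    unfolding ideal by (rule squarefree_square_equigenerated[OF V card_member])
  have quotients: "has_linear_quotients V
      (Idl\<^bsub>poly_ring V\<^esub> ((monom :: _ \<Rightarrow> ('v, 'k) mpoly) ` squarefree_exp ` set us))"
    if order: "linear_quotient_order us" and us: "\<And>U. U \<in> set us \<Longrightarrow> U \<subseteq> V" for us
    by (rule linear_quotients_of_order[OF V(1) us order])
  obtain us where us: "set us = facets \<Delta>" "linear_quotient_order us"
    using ex_linear_quotient_order[OF uniform_forest_axioms exchange] by blast
  have "\<exists>ws. set ws = disjoint_unions (facets \<Delta>) \<and> linear_quotient_order ws"
  proof (cases "?n = 0")
    case True
    \<comment> \<open>The empty set is the only possible facet, and it is disjoint from itself.\<close>
    then have "F = {}" if "F \<in> facets \<Delta>" for F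
      using card_member[OF that] finite_member[OF that] by simp
    then have "disjoint_unions (facets \<Delta>) = {} \<or> disjoint_unions (facets \<Delta>) = {{}}"
      unfolding disjoint_unions_def by blast
    moreover have "linear_quotient_order [{}]" by (simp add: linear_quotient_order_def)
    ultimately show ?thesis by (metis empty_set linear_quotient_order_Nil list.simps(15))
  next
    case False
    then show ?thesis
      by (intro ex_linear_quotient_order_disjoint_unions[OF uniform_forest_axioms exchange]) simp
  qed
  then obtain ws where ws: "set ws = disjoint_unions (facets \<Delta>)" "linear_quotient_order ws"
    by blast
  have "U \<subseteq> V" if "U \<in> set us" for U using that us(1) V(2) by simp
  then have "has_linear_quotients V (facet_ideal V \<Delta> :: ('v, 'k) mpoly set)"
    unfolding ideal us(1)[symmetric] by (rule quotients[OF us(2)])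
  moreover have "U \<subseteq> V" if "U \<in> set ws" for U
    using that V(2) unfolding ws(1) disjoint_unions_def by blast
  then have "has_linear_quotients V (squarefree_power V (facet_ideal V \<Delta> :: ('v, 'k) mpoly set) 2)"
    unfolding square ws(1)[symmetric] by (rule quotients[OF ws(2)])
  ultimately show ?thesis by blast
qed

end
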